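(* Let $(E,(\cdot,\cdot),\mathcal H)$ be an extended affine Lie algebra (of reduced type) with root system $R$ such that $\mathrm{rank}(R)>1$ and $\mathrm{ind}(R)=0$. Let $\mathcal C$ be the group of Cartan automorphisms of $E$, let $\chi$ be the group of characters for $R$ (under pointwise multiplication), let $\mathcal I:=\{\psi\in\mathrm{Aut}(E)\mid \psi|_{\mathcal H}=-\mathrm{id}_{\mathcal H}\}$, and let $\mathcal C^{\mathrm{fin}},\chi^{\mathrm{fin}},\mathcal I^{\mathrm{fin}}$ be the sets of finite order elements of $\mathcal C,\chi,\mathcal I$, respectively. Then (i) $\mathcal C^{\mathrm{fin}}\cong\chi^{\mathrm{fin}}$; (ii) for any $\tau\in\mathcal I^{\mathrm{fin}}$, $\tau\,\mathcal C^{\mathrm{fin}}\subseteq\mathcal I^{\mathrm{fin}}$.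
   Context: All vector spaces are over $\mathbb C$. An extended affine Lie algebra is a triple $(E,(\cdot,\cdot),\mathcal H)$ where $E$ is a Lie algebra, $\mathcal H$ is a non-trivial finite dimensional subalgebra and $(\cdot,\cdot)$ is a symmetric bilinear form on $E$ such that: (A1) the form is invariant and non-degenerate; (A2) $E=\sum_{\alpha\in R}E_\alpha$ with $E_\alpha=\{x\in E\mid [h,x]=\alpha(h)x\ \forall h\in\mathcal H\}$, $R=\{\alpha\in\mathcal H^\star\mid E_\alpha\neq\{0\}\}$ and $E_0=\mathcal H$ ($R$ is the root system of $E$); the form restricted to $\mathcal H$ is then non-degenerate, $t_\alpha\in\mathcal H$ is defined by $\alpha(h)=(h,t_\alpha)$, and $(\alpha,\beta):=(t_\alpha,t_\beta)$ on $\mathcal H^\star$; $R^0=\{\alpha\in R\mid(\alpha,\alpha)=0\}$ (isotropic roots), $R^\times=R\setminus R^0$ (non-isotropic roots), and the core $E_c$ is the subalgebra generated by $E_\alpha$, $\alpha\in R^\times$; (A3) $\mathrm{ad}(x)$ is locally nilpotent for $x\in E_\alpha$, $\alpha\in R^\times$; (A4) (tameness) the centralizer of $E_c$ in $E$ is contained in $E_c$; (A5) the $\mathbb Z$-span of $R$ is a free abelian group of finite rank; (A6) if $R^\times=R_1\uplus R_2$ with $R_1,R_2$ non-empty then $R_1\not\perp R_2$. Let $\mathcal V=\mathrm{span}_{\mathbb R}R$, $\mathcal V^0=\mathrm{span}_{\mathbb R}R^0$. The image $\bar R$ of $R$ in $\mathcal V/\mathcal V^0$ is an irreducible finite root system;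 its rank and type are called the rank and type of $R$ (and of $E$). Reduced type means $\bar R$ is reduced. The nullity of $R$ is $\dim\mathcal V^0$, and $\langle R\rangle$ denotes the $\mathbb Z$-span of $R$, a free abelian group of rank $\mathrm{rank}(R)+\mathrm{null}(R)$. Index: for $\alpha\in R^\times$ let $w_\alpha(\beta)=\beta-\frac{2(\alpha,\beta)}{(\alpha,\alpha)}\alpha$. For $\mathcal P\subseteq R^\times$ let $\mathcal W_{\mathcal P}$ be the group generated by $w_\alpha$, $\alpha\in\mathcal P$. A reflectable base is a subset $\mathcal P\subseteq R^\times$ with $\mathcal W_{\mathcal P}\mathcal P=R^\times$ such that no proper subset of $\mathcal P$ has this property (reflectable bases are finite). $\mathrm{refl}(R)$ is the smallest cardinality of a reflectable base, and $\mathrm{ind}(R):=\mathrm{refl}(R)-\mathrm{rank}\langle R\rangle$. A Cartan automorphism of $E$ is an automorphism $\Psi$ with $\Psi(h)=h$ for all $h\in\mathcal H$. A character for $R$ is a map $\psi:R\to\mathbb C^\times$ with $\psi(\alpha+\beta)=\psi(\alpha)\psi(\beta)$ whenever $\alpha,\beta,\alpha+\beta\in R$; it is of finite order if there is $m\in\mathbb Z_{>0}$ with $\psi(\alpha)^m=1$ for all $\alpha\in R$. In (i), $\cong$ means isomorphism of groups. *)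

theory Defs
  imports
    Complex_Main
    "HOL-Library.Function_Algebras"
    "HOL-Library.FuncSet"
    "HOL-Library.Extended_Real"
    "HOL-Algebra.Bij"
    "HOL-Algebra.Coset"
    "HOL-Algebra.Generated_Groups"
begin

section \<open>Elements of finite order in a group\<close>

definition finite_order :: "('a, 'b) monoid_scheme \<Rightarrow> 'a \<Rightarrow> bool" where
  "finite_order G x \<longleftrightarrow> (\<exists>m::nat. m > 0 \<and> x [^]\<^bsub>G\<^esub> m = \<one>\<^bsub>G\<^esub>)"

definition fin_part :: "('a, 'b) monoid_scheme \<Rightarrow> ('a, 'b) monoid_scheme" where
  "fin_part G = G\<lparr>carrier := {x \<in> carrier G. finite_order G x}\<rparr>"


section \<open>Functionals as real vectors and as elements of an abelian group\<close>

definition rscale :: "real \<Rightarrow> ('e \<Rightarrow> complex) \<Rightarrow> ('e \<Rightarrow> complex)" where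
  "rscale r \<alpha> = (\<lambda>x. of_real r * \<alpha> x)"

definition zscale :: "int \<Rightarrow> ('e \<Rightarrow> complex) \<Rightarrow> ('e \<Rightarrow> complex)" where
  "zscale n \<alpha> = (\<lambda>x. of_int n * \<alpha> x)"

definition cscale :: "complex \<Rightarrow> ('e \<Rightarrow> complex) \<Rightarrow> ('e \<Rightarrow> complex)" where
  "cscale c \<alpha> = (\<lambda>x. c * \<alpha> x)"

global_interpretation real_fun: vector_space "rscale :: real \<Rightarrow> ('e \<Rightarrow> complex) \<Rightarrow> _"
  by unfold_locales (auto simp: rscale_def fun_eq_iff algebra_simps)

global_interpretation int_fun: module "zscale :: int \<Rightarrow> ('e \<Rightarrow> complex) \<Rightarrow> _"
  by unfold_locales (auto simp: zscale_def fun_eq_iff algebra_simps)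


section \<open>Complex Lie algebras\<close>

locale complex_lie_algebra = vector_space scale
  for scale :: "complex \<Rightarrow> 'e::ab_group_add \<Rightarrow> 'e" +
  fixes bracket :: "'e \<Rightarrow> 'e \<Rightarrow> 'e"
  assumes bracket_add_left: "bracket (x + y) z = bracket x z + bracket y z"
    and bracket_add_right: "bracket x (y + z) = bracket x y + bracket x z"
    and bracket_scale_left: "bracket (scale c x) y = scale c (bracket x y)"
    and bracket_scale_right: "bracket x (scale c y) = scale c (bracket x y)"
    and bracket_self: "bracket x x = 0"
    and jacobi: "bracket x (bracket y z) + bracket y (bracket z x) + bracket z (bracket x y) = 0"
begin

definition subalgebra :: "'e set \<Rightarrow> bool" where
  "subalgebra L \<longleftrightarrow> subspace L \<and> (\<forall>x\<in>L. \<forall>y\<in>L. bracket x y \<in> L)"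

definition Aut :: "('e \<Rightarrow> 'e) monoid" where
  "Aut = \<lparr>carrier = {f. Vector_Spaces.linear scale scale f \<and> bij f \<and>
                        (\<forall>x y. f (bracket x y) = bracket (f x) (f y))},
          mult = (\<circ>), one = id\<rparr>"

end


section \<open>Root-theoretic notions\<close>

locale lie_algebra_with_form = complex_lie_algebra scale bracket
  for scale :: "complex \<Rightarrow> 'e::ab_group_add \<Rightarrow> 'e" and bracket :: "'e \<Rightarrow> 'e \<Rightarrow> 'e" +
  fixes form :: "'e \<Rightarrow> 'e \<Rightarrow> complex" and H :: "'e set"
begin

text \<open>A functional on \<open>H\<close> is represented by its extension by \<open>0\<close> to the whole type, so that the
  dual space of \<open>H\<close> is closed under the pointwise operations on functions.\<close>

definition dual :: "('e \<Rightarrow> complex) set" where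
  "dual = {\<alpha>. (\<forall>x\<in>H. \<forall>y\<in>H. \<alpha> (x + y) = \<alpha> x + \<alpha> y) \<and>
              (\<forall>c. \<forall>x\<in>H. \<alpha> (scale c x) = c * \<alpha> x) \<and> (\<forall>x. x \<notin> H \<longrightarrow> \<alpha> x = 0)}"

definition root_space :: "('e \<Rightarrow> complex) \<Rightarrow> 'e set" where
  "root_space \<alpha> = {x. \<forall>h\<in>H. bracket h x = scale (\<alpha> h) x}"

definition roots :: "('e \<Rightarrow> complex) set" where
  "roots = {\<alpha> \<in> dual. root_space \<alpha> \<noteq> {0}}"

definition t :: "('e \<Rightarrow> complex) \<Rightarrow> 'e" where
  "t \<alpha> = (THE u. u \<in> H \<and> (\<forall>h\<in>H. \<alpha> h = form h u))"

definition dual_form :: "('e \<Rightarrow> complex) \<Rightarrow> ('e \<Rightarrow> complex) \<Rightarrow> complex" where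
  "dual_form \<alpha> \<beta> = form (t \<alpha>) (t \<beta>)"

definition isotropic_roots :: "('e \<Rightarrow> complex) set" where
  "isotropic_roots = {\<alpha> \<in> roots. dual_form \<alpha> \<alpha> = 0}"

definition nonisotropic_roots :: "('e \<Rightarrow> complex) set" where
  "nonisotropic_roots = roots - isotropic_roots"

definition core :: "'e set" where
  "core = subalgebra hull (\<Union>\<alpha>\<in>nonisotropic_roots. root_space \<alpha>)"

text \<open>The real spaces \<open>V = span R\<close> and \<open>V0 = span R0\<close>; \<open>proj\<close> is the projection to the cosets of
  \<open>V0\<close>, which are the elements of \<open>V/V0\<close>.\<close>

definition V :: "('e \<Rightarrow> complex) set" where
  "V = real_fun.span roots"

definition V0 :: "('e \<Rightarrow> complex) set" where
  "V0 = real_fun.span isotropic_roots"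

definition proj :: "('e \<Rightarrow> complex) \<Rightarrow> ('e \<Rightarrow> complex) set" where
  "proj v = {w. w - v \<in> V0}"

definition quotient_roots :: "('e \<Rightarrow> complex) set set" where
  "quotient_roots = proj ` roots"

text \<open>The dimension of \<open>V/V0\<close>: the size of a set \<open>B\<close> of representatives of a basis.\<close>

definition root_rank :: nat where
  "root_rank = (THE n. \<exists>B. finite B \<and> card B = n \<and> B \<subseteq> V \<and>
     (\<forall>v\<in>V. \<exists>!c. c \<in> B \<rightarrow>\<^sub>E (UNIV :: real set) \<and> proj v = proj (\<Sum>b\<in>B. rscale (c b) b)))"

text \<open>Root systems contain \<open>0\<close> here, hence the multiple \<open>0\<close> is allowed.\<close>

definition reduced_type :: bool where
  "reduced_type \<longleftrightarrow>
     (\<forall>\<alpha>\<in>roots. \<forall>r. proj \<alpha> \<noteq> proj 0 \<and> proj (rscale r \<alpha>) \<in> quotient_roots \<longrightarrow> r \<in> {-1, 0, 1})"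

definition lattice_basis :: "('e \<Rightarrow> complex) set \<Rightarrow> bool" where
  "lattice_basis B \<longleftrightarrow> int_fun.independent B \<and> int_fun.span B = int_fun.span roots"

definition lattice_rank :: nat where
  "lattice_rank = (THE n. \<exists>B. finite B \<and> card B = n \<and> lattice_basis B)"

definition reflection :: "('e \<Rightarrow> complex) \<Rightarrow> ('e \<Rightarrow> complex) \<Rightarrow> ('e \<Rightarrow> complex)" where
  "reflection \<alpha> = (\<lambda>\<beta>\<in>dual. \<beta> - cscale (2 * dual_form \<alpha> \<beta> / dual_form \<alpha> \<alpha>) \<alpha>)"

definition refl_group :: "('e \<Rightarrow> complex) set \<Rightarrow> (('e \<Rightarrow> complex) \<Rightarrow> ('e \<Rightarrow> complex)) set" where
  "refl_group P = generate (BijGroup dual) (reflection ` P)"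

definition reflectable :: "('e \<Rightarrow> complex) set \<Rightarrow> bool" where
  "reflectable P \<longleftrightarrow> P \<subseteq> nonisotropic_roots \<and>
     {w \<alpha> |w \<alpha>. w \<in> refl_group P \<and> \<alpha> \<in> P} = nonisotropic_roots"

definition reflectable_base :: "('e \<Rightarrow> complex) set \<Rightarrow> bool" where
  "reflectable_base P \<longleftrightarrow> reflectable P \<and> (\<forall>Q. Q \<subset> P \<longrightarrow> \<not> reflectable Q)"

text \<open>As an infimum in \<^typ>\<open>enat\<close>, this would be \<open>\<infinity>\<close> (and not a junk number) if there were no finite
  reflectable base; the index is an extended real for this reason only.\<close>

definition refl_number :: enat where
  "refl_number = (INF P \<in> {P. reflectable_base P \<and> finite P}. enat (card P))"

definition root_index :: ereal where
  "root_index = ereal_of_enat refl_number - ereal (real lattice_rank)"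

definition Cartan_group :: "('e \<Rightarrow> 'e) monoid" where
  "Cartan_group = Aut\<lparr>carrier := {\<Psi> \<in> carrier Aut. \<forall>h\<in>H. \<Psi> h = h}\<rparr>"

definition character_group :: "(('e \<Rightarrow> complex) \<Rightarrow> complex) monoid" where
  "character_group =
     \<lparr>carrier = {\<psi> \<in> roots \<rightarrow>\<^sub>E (UNIV - {0}).
                  \<forall>\<alpha>\<in>roots. \<forall>\<beta>\<in>roots. \<alpha> + \<beta> \<in> roots \<longrightarrow> \<psi> (\<alpha> + \<beta>) = \<psi> \<alpha> * \<psi> \<beta>},
      mult = (\<lambda>\<psi> \<phi>. \<lambda>\<alpha>\<in>roots. \<psi> \<alpha> * \<phi> \<alpha>),
      one = (\<lambda>\<alpha>\<in>roots. 1)\<rparr>"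

definition neg_auts :: "('e \<Rightarrow> 'e) set" where
  "neg_auts = {\<tau> \<in> carrier Aut. \<forall>h\<in>H. \<tau> h = - h}"

definition neg_auts_fin :: "('e \<Rightarrow> 'e) set" where
  "neg_auts_fin = {\<tau> \<in> neg_auts. finite_order Aut \<tau>}"

end


section \<open>Extended affine Lie algebras\<close>

locale eala = lie_algebra_with_form scale bracket form H
  for scale :: "complex \<Rightarrow> 'e::ab_group_add \<Rightarrow> 'e" and bracket :: "'e \<Rightarrow> 'e \<Rightarrow> 'e"
    and form :: "'e \<Rightarrow> 'e \<Rightarrow> complex" and H :: "'e set" +
  assumes H_subalgebra: "subalgebra H"
    and H_nontrivial: "H \<noteq> {0}"
    and H_finite_dim: "\<exists>B. finite B \<and> span B = H"
    and form_sym: "form x y = form y x"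
    and form_add: "form (x + y) z = form x z + form y z"
    and form_scale: "form (scale c x) y = c * form x y"
    and form_invariant: "form (bracket x y) z = form x (bracket y z)"
    and form_nondegenerate: "(\<forall>y. form x y = 0) \<Longrightarrow> x = 0"
    and root_decomposition: "span (\<Union>\<alpha>\<in>roots. root_space \<alpha>) = UNIV"
    and root_space_zero: "root_space 0 = H"
    and ad_locally_nilpotent:
      "\<alpha> \<in> nonisotropic_roots \<Longrightarrow> x \<in> root_space \<alpha> \<Longrightarrow> \<exists>n. (bracket x ^^ n) y = 0"
    and tame: "{x. \<forall>y\<in>core. bracket x y = 0} \<subseteq> core"
    and lattice_free: "\<exists>B. finite B \<and> lattice_basis B"
    and irreducible:
      "nonisotropic_roots = R1 \<union> R2 \<Longrightarrow> R1 \<inter> R2 = {} \<Longrightarrow> R1 \<noteq> {} \<Longrightarrow> R2 \<noteq> {} \<Longrightarrow>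
       \<exists>\<alpha>\<in>R1. \<exists>\<beta>\<in>R2. dual_form \<alpha> \<beta> \<noteq> 0"

end

theory Submission
  imports Defs
begin

text \<open>
  A character \<open>\<psi>\<close> acts on \<open>E\<close> as the diagonal map that multiplies each root space \<open>E\<^sub>\<alpha>\<close> by \<open>\<psi> \<alpha>\<close>. This
  is a Cartan automorphism, of finite order if \<open>\<psi>\<close> is, and \<open>\<psi>\<close> can be read off from it. So both claims
  rest on the converse, \<open>finite_order_Cartan_is_diagonal\<close>: every Cartan automorphism \<open>\<Psi>\<close> of finite order is
  diagonal for some character. The second claim follows since an automorphism \<open>\<tau>\<close> that is \<open>- id\<close> on \<open>H\<close>
  exchanges \<open>E\<^sub>\<alpha>\<close> and \<open>E\<^sub>-\<^sub>\<alpha>\<close>, so that \<open>\<tau> \<Psi> \<tau>\<^sup>-\<^sup>1 = \<Psi>\<^sup>-\<^sup>1\<close> and \<open>(\<tau> \<Psi>)\<^sup>2 = \<tau>\<^sup>2\<close>.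

  For the converse, \<open>\<Psi>\<close> preserves root spaces, and those of non-isotropic roots are one-dimensional by
  sl2-theory. Index zero provides a reflectable base \<open>P\<close> with as many elements as the rank of the root
  lattice. It spans that lattice: non-isotropic roots are reflections of elements of \<open>P\<close> and Cartan
  integers are integers, and by tameness every isotropic root is an integral combination of
  non-isotropic ones. Hence \<open>P\<close> is a basis of the lattice, and the eigenvalues of \<open>\<Psi>\<close> on the \<open>E\<^sub>\<alpha>\<close>,
  \<open>\<alpha> \<in> P\<close>, extend to a character \<open>\<psi>\<close> of the lattice. The automorphisms \<open>\<Psi>\<close> and \<open>diagonal \<psi>\<close> agree on \<open>E\<^sub>\<alpha>\<close> for
  \<open>\<alpha> \<in> P\<close>, then on \<open>E\<^sub>-\<^sub>\<alpha>\<close>, and, since powers of \<open>ad E\<^sub>\<plusminus>\<^sub>\<alpha>\<close> carry \<open>E\<^sub>\<beta>\<close> onto the root space of the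
  reflection of \<open>\<beta>\<close>, on all root spaces of non-isotropic roots and on the core they generate.

  Root spaces of isotropic roots can have a higher dimension, and it is only here that finite order
  enters: for \<open>x \<in> E\<^sub>\<sigma>\<close> the vector \<open>u = \<Psi> x - \<psi> \<sigma> x\<close> centralizes the core, so by tameness it lies in the
  core, and a nonzero \<open>u\<close> would be part of a Jordan block of \<open>\<Psi>\<close>. This uses that \<open>[E\<^sub>\<sigma>, E\<^sub>\<alpha>]\<close> lies in the
  core for every root \<open>\<sigma>\<close> and non-isotropic \<open>\<alpha>\<close>, which follows from the orthogonality of isotropic roots
  to all roots.
\<close>

section \<open>Locally nilpotent representations of sl2\<close>

text \<open>
  The relations \<open>[h, e] = 2 e\<close> and \<open>[h, f] = - 2 f\<close> appear through their effect on eigenvectors of \<open>h\<close>,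
  the only vectors to which they are applied.
\<close>

locale sl2_action = vector_space scale
  for scale :: "complex \<Rightarrow> 'v::ab_group_add \<Rightarrow> 'v" +
  fixes e f h :: "'v \<Rightarrow> 'v"
  assumes linear_e: "Vector_Spaces.linear scale scale e"
    and linear_f: "Vector_Spaces.linear scale scale f"
    and commutator: "e (f x) = f (e x) + h x"
    and weight_e: "h x = scale c x \<Longrightarrow> h (e x) = scale (c + 2) (e x)"
    and weight_f: "h x = scale c x \<Longrightarrow> h (f x) = scale (c - 2) (f x)"
    and nilpotent_e: "\<exists>n. (e ^^ n) x = 0"
    and nilpotent_f: "\<exists>n. (f ^^ n) x = 0"
begin

sublocale E: Vector_Spaces.linear scale scale e by (rule linear_e)
sublocale F: Vector_Spaces.linear scale scale f by (rule linear_f)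

lemma weight_e_power: "h x = scale c x \<Longrightarrow> h ((e ^^ k) x) = scale (c + 2 * of_nat k) ((e ^^ k) x)"
  by (induction k) (use weight_e in \<open>fastforce simp: algebra_simps\<close>)+

lemma weight_f_power: "h x = scale c x \<Longrightarrow> h ((f ^^ k) x) = scale (c - 2 * of_nat k) ((f ^^ k) x)"
  by (induction k) (use weight_f in \<open>fastforce simp: algebra_simps\<close>)+

lemma last_nonzero_power:
  fixes g :: "'v \<Rightarrow> 'v"
  assumes "x \<noteq> 0" "\<exists>n. (g ^^ n) x = 0"
  obtains k where "(g ^^ k) x \<noteq> 0" "(g ^^ Suc k) x = 0"
proof -
  obtain n where "(g ^^ n) x = 0" "\<forall>i<n. (g ^^ i) x \<noteq> 0"
    using exists_least_iff[of "\<lambda>n. (g ^^ n) x = 0"] assms(2) by blast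
  then show thesis
    using assms(1) that by (cases n) auto
qed

lemma f_e_power:
  assumes "f x = 0" "h x = scale c x"
  shows "f ((e ^^ Suc k) x) = scale (- of_nat (Suc k) * (c + of_nat k)) ((e ^^ k) x)"
proof (induction k)
  case 0
  have "f (e x) = - h x"
    using commutator[of x] assms(1) E.zero by (simp add: eq_neg_iff_add_eq_0)
  then show ?case
    using assms(2) by (simp add: scale_minus_left)
next
  case (Suc k)
  let ?y = "(e ^^ Suc k) x"
  have "f (e ?y) = e (f ?y) - h ?y"
    unfolding commutator[of ?y] by simp
  also have "\<dots> = scale (- of_nat (Suc k) * (c + of_nat k)) ?y - scale (c + 2 * of_nat (Suc k)) ?y"
    unfolding Suc weight_e_power[OF assms(2)] by (simp add: E.scale)
  also have "\<dots> = scale (- of_nat (Suc (Suc k)) * (c + of_nat (Suc k))) ?y"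
    unfolding scale_left_diff_distrib[symmetric] by (rule arg_cong[where f = "\<lambda>a. scale a ?y"]) (simp add: algebra_simps)
  finally show ?case by simp
qed

text \<open>
  Some power of \<open>e\<close> kills \<open>x\<close>, so one of the coefficients \<open>(k + 1) (c + k)\<close> that measure
  how far \<open>f\<close> undoes a step of \<open>e\<close> vanishes.
\<close>

lemma lowest_weight:
  assumes "x \<noteq> 0" "f x = 0" "h x = scale c x"
  obtains k :: nat where "c = - of_nat k"
proof -
  obtain k where k: "(e ^^ k) x \<noteq> 0" "(e ^^ Suc k) x = 0"
    using last_nonzero_power[OF assms(1) nilpotent_e] .
  have "scale (- of_nat (Suc k) * (c + of_nat k)) ((e ^^ k) x) = 0"
    using f_e_power[OF assms(2,3), of k] k(2) F.zero by (simp only:)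
  then have "- (of_nat (Suc k) :: complex) * (c + of_nat k) = 0"
    using k(1) by (simp only: scale_eq_0_iff simp_thms)
  then have "c = - of_nat k"
    by (metis add_eq_0_iff2 mult_eq_0_iff neg_equal_0_iff_equal of_nat_eq_0_iff nat.distinct(2) add.commute)
  then show thesis by (rule that)
qed

text \<open>
  The last nonzero vector among the \<open>f\<^sup>k x\<close> is a lowest weight vector.
\<close>

lemma integral_weight:
  assumes "x \<noteq> 0" "h x = scale c x"
  obtains n :: int where "c = of_int n"
proof -
  obtain k where k: "(f ^^ k) x \<noteq> 0" "(f ^^ Suc k) x = 0"
    using last_nonzero_power[OF assms(1) nilpotent_f] .
  obtain j :: nat where "c - 2 * of_nat k = - of_nat j"
    using lowest_weight[OF k(1) _ weight_f_power[OF assms(2)]] k(2) by auto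
  then have "c = of_int (2 * int k - int j)"
    by (simp add: algebra_simps)
  then show thesis by (rule that)
qed

lemma e_f_power:
  assumes "h x = scale n x"
  shows "e ((f ^^ Suc j) x) = (f ^^ j) (f (e x) + scale (of_nat (Suc j) * (n - of_nat j)) x)"
proof (induction j)
  case 0
  then show ?case using assms by (simp add: commutator)
next
  case (Suc j)
  let ?y = "(f ^^ Suc j) x"
  have linear_power: "(f ^^ k) (u + scale c v) = (f ^^ k) u + scale c ((f ^^ k) v)" for k c u v
    by (induction k) (simp_all add: F.add F.scale)
  have "e (f ?y) = f (e ?y) + h ?y"
    by (rule commutator)
  also have "\<dots> = f ((f ^^ j) (f (e x) + scale (of_nat (Suc j) * (n - of_nat j)) x))
      + scale (n - 2 * of_nat (Suc j)) ?y"
    unfolding Suc weight_f_power[OF assms] ..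
  also have "\<dots> = (f ^^ Suc j) (f (e x)) + scale (of_nat (Suc (Suc j)) * (n - of_nat (Suc j))) ?y"
    by (simp add: linear_power F.add F.scale add.assoc flip: scale_left_distrib)
       (simp add: algebra_simps)
  finally show ?case
    by (simp add: linear_power F.add F.scale)
qed

text \<open>
  If \<open>f e\<close> had a negative integral eigenvalue on a vector of weight \<open>n \<ge> 0\<close>, each step up by \<open>e\<close> would
  lower the eigenvalue further, by the current weight, so that no power of \<open>e\<close> could ever kill the
  vector.
\<close>

lemma f_e_no_negative_eigenvalue:
  assumes "x \<noteq> 0" "h x = scale (of_nat n) x"
  shows "f (e x) \<noteq> scale (- of_nat (Suc c)) x"
proof
  assume fe: "f (e x) = scale (- of_nat (Suc c)) x"
  have "(e ^^ k) x \<noteq> 0 \<and> (\<exists>d. f ((e ^^ Suc k) x) = scale (- of_nat (Suc d)) ((e ^^ k) x))" for k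
  proof (induction k)
    case 0
    then show ?case using assms(1) fe by (auto intro!: exI[of _ c])
  next
    case (Suc k)
    then obtain d where nz: "(e ^^ k) x \<noteq> 0"
      and d: "f ((e ^^ Suc k) x) = scale (- of_nat (Suc d)) ((e ^^ k) x)"
      by blast
    let ?y = "(e ^^ Suc k) x"
    have "?y \<noteq> 0"
    proof
      assume "?y = 0"
      then have "scale (- of_nat (Suc d)) ((e ^^ k) x) = 0"
        using d F.zero by (simp only:)
      then show False
        using nz by (simp only: scale_eq_0_iff neg_equal_0_iff_equal of_nat_eq_0_iff nat.distinct simp_thms)
    qed
    moreover have "f (e ?y) = scale (- of_nat (Suc (d + (n + 2 * Suc k)))) ?y"
    proof -
      have "f (e ?y) = e (f ?y) - h ?y"
        unfolding commutator[of ?y] by simp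
      also have "\<dots> = scale (- of_nat (Suc d)) ?y - scale (of_nat n + 2 * of_nat (Suc k)) ?y"
        unfolding d weight_e_power[OF assms(2)] by (simp add: E.scale)
      also have "\<dots> = scale (- of_nat (Suc (d + (n + 2 * Suc k)))) ?y"
        unfolding scale_left_diff_distrib[symmetric] by (rule arg_cong[where f = "\<lambda>a. scale a ?y"]) simp
      finally show ?thesis .
    qed
    ultimately show ?case
      unfolding funpow.simps(2) o_apply by blast
  qed
  then show False using nilpotent_e by blast
qed

text \<open>
  On vectors of weight \<open>n\<close> one has \<open>e f\<^sup>j\<^sup>+\<^sup>1 = f\<^sup>j (f e + (j + 1) (n - j))\<close>, and for \<open>j < n\<close> the bracketed
  operator is injective because \<open>f e\<close> has no negative integral eigenvalue. So injectivity passes from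
  \<open>f\<^sup>j\<close> to \<open>f\<^sup>j\<^sup>+\<^sup>1\<close> without decomposing the module into irreducible ones.
\<close>

lemma f_power_nonzero:
  assumes "x \<noteq> 0" "h x = scale (of_nat n) x" "j \<le> n"
  shows "(f ^^ j) x \<noteq> 0"
  using assms
proof (induction j arbitrary: x)
  case 0
  then show ?case by simp
next
  case (Suc j)
  let ?c = "Suc j * (n - j)"
  let ?z = "f (e x) + scale (of_nat ?c) x"
  have hz: "h ?z = scale (of_nat n) ?z"
  proof -
    have w: "h (f (e x)) = scale (of_nat n) (f (e x))"
      using weight_f[OF weight_e[OF Suc.prems(2)]] by simp
    have hef: "h u = e (f u) - f (e u)" for u
      by (simp add: commutator)
    have "h ?z = h (f (e x)) + scale (of_nat ?c) (h x)"
      unfolding hef by (simp add: E.add F.add E.scale F.scale scale_right_diff_distrib)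
    then show ?thesis
      unfolding w Suc.prems(2) by (simp only: scale_right_distrib scale_scale mult.commute)
  qed
  obtain d where d: "?c = Suc d"
    using Suc.prems(3) by (cases ?c) auto
  have "?z \<noteq> 0"
  proof
    assume "?z = 0"
    then have "f (e x) = - scale (of_nat ?c) x"
      by (simp only: eq_neg_iff_add_eq_0)
    then have "f (e x) = scale (- of_nat (Suc d)) x"
      by (simp only: d scale_minus_left)
    then show False
      using f_e_no_negative_eigenvalue[OF Suc.prems(1,2)] by blast
  qed
  then have "(f ^^ j) ?z \<noteq> 0"
    using Suc.IH[OF _ hz] Suc.prems(3) by simp
  moreover have "e ((f ^^ Suc j) x) = (f ^^ j) ?z"
    unfolding e_f_power[OF Suc.prems(2)] of_nat_mult using Suc.prems(3) by (simp only: of_nat_diff Suc_leD)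
  ultimately show ?case
    using E.zero by auto
qed

end

section \<open>Weight spaces and the dual of the Cartan subalgebra\<close>

context complex_lie_algebra
begin

lemma linear_bracket: "Vector_Spaces.linear scale scale (bracket x)"
  by unfold_locales (simp_all add: bracket_add_right bracket_scale_right)

lemma bracket_zero [simp]: "bracket x 0 = 0" "bracket 0 x = 0"
  using bracket_scale_right[of x 0 0] bracket_scale_left[of 0 0 x] by simp_all

lemma bracket_anticomm: "bracket x y = - bracket y x"
proof -
  have "bracket x y + bracket y x = bracket (x + y) (x + y)"
    unfolding bracket_add_left bracket_add_right by (simp add: bracket_self)
  then show ?thesis
    by (simp add: bracket_self eq_neg_iff_add_eq_0)
qed

lemma bracket_minus [simp]: "bracket x (- y) = - bracket x y" "bracket (- x) y = - bracket x y"
  using bracket_scale_right[of x "- 1" y] bracket_scale_left[of "- 1" x y] by simp_all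

lemma bracket_diff:
  "bracket x (y - z) = bracket x y - bracket x z" "bracket (x - y) z = bracket x z - bracket y z"
  using bracket_add_right[of x y "- z"] bracket_add_left[of x "- y" z] by simp_all

lemma bracket_derivation:
  "bracket x (bracket y z) = bracket (bracket x y) z + bracket y (bracket x z)"
proof -
  have "bracket x (bracket y z) - bracket y (bracket x z) - bracket (bracket x y) z
      = bracket x (bracket y z) + bracket y (bracket z x) + bracket z (bracket x y)"
    by (simp add: bracket_anticomm[of x z] bracket_anticomm[of "bracket x y" z])
  then show ?thesis
    unfolding jacobi by (simp add: algebra_simps)
qed

lemma subalgebra_hull: "subalgebra (subalgebra hull S)"
  by (rule hull_in) (auto simp: subalgebra_def subspace_def)

lemma subalgebra_span:
  assumes "\<And>x y. x \<in> A \<Longrightarrow> y \<in> A \<Longrightarrow> bracket x y \<in> span A"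
  shows "subalgebra (span A)"
  unfolding subalgebra_def
proof (intro conjI ballI)
  fix x y assume "x \<in> span A" and y: "y \<in> span A"
  then show "bracket x y \<in> span A"
  proof (induction rule: span_induct_alt)
    case (step c u v)
    have "bracket u y \<in> span A"
      using y
      by (induction rule: span_induct_alt)
        (auto simp: bracket_add_right bracket_scale_right assms step.hyps span_add span_scale span_zero)
    with step.IH y show ?case
      by (simp add: bracket_add_left bracket_scale_left span_add span_scale)
  qed (simp add: span_zero)
qed simp

end

context lie_algebra_with_form
begin

lemma dual_add: "\<alpha> \<in> dual \<Longrightarrow> \<beta> \<in> dual \<Longrightarrow> \<alpha> + \<beta> \<in> dual"
  by (auto simp: dual_def algebra_simps)

lemma dual_cscale: "\<alpha> \<in> dual \<Longrightarrow> cscale c \<alpha> \<in> dual"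
  by (auto simp: dual_def cscale_def algebra_simps)

lemma dual_minus: "\<alpha> \<in> dual \<Longrightarrow> - \<alpha> \<in> dual"
  using dual_cscale[of \<alpha> "- 1"] by (simp add: cscale_def fun_Compl_def)

lemma dual_diff: "\<alpha> \<in> dual \<Longrightarrow> \<beta> \<in> dual \<Longrightarrow> \<alpha> - \<beta> \<in> dual"
  using dual_add[OF _ dual_minus, of \<alpha> \<beta>] by simp

lemma dual_zero: "0 \<in> dual"
  by (simp add: dual_def)

lemma cscale_of_int: "cscale (of_int n) = zscale n"
  by (simp add: fun_eq_iff cscale_def zscale_def)

lemma dual_zscale: "\<alpha> \<in> dual \<Longrightarrow> zscale n \<alpha> \<in> dual"
  using dual_cscale[of \<alpha> "of_int n"] by (simp add: cscale_of_int)

lemma dual_differ: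
  assumes "\<alpha> \<in> dual" "\<beta> \<in> dual" "\<alpha> \<noteq> \<beta>"
  obtains h where "h \<in> H" "\<alpha> h \<noteq> \<beta> h"
  using assms by (auto simp: dual_def fun_eq_iff) metis

lemma root_spaceD: "x \<in> root_space \<alpha> \<Longrightarrow> h \<in> H \<Longrightarrow> bracket h x = scale (\<alpha> h) x"
  by (simp add: root_space_def)

lemma subspace_root_space: "subspace (root_space \<alpha>)"
  by (auto simp: subspace_def root_space_def bracket_add_right bracket_scale_right
      scale_right_distrib scale_left_commute)

lemmas root_space_closed =
  subspace_root_space[THEN subspace_0] subspace_root_space[THEN subspace_add]
  subspace_root_space[THEN subspace_diff] subspace_root_space[THEN subspace_scale]
  subspace_root_space[THEN subspace_sum] subspace_root_space[THEN subspace_neg]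

lemma root_space_bracket:
  assumes "x \<in> root_space \<alpha>" "y \<in> root_space \<beta>"
  shows "bracket x y \<in> root_space (\<alpha> + \<beta>)"
  using assms
  by (simp add: root_space_def bracket_derivation[of _ x y] bracket_scale_left bracket_scale_right
      scale_left_distrib)

lemma rootI: "\<alpha> \<in> dual \<Longrightarrow> x \<in> root_space \<alpha> \<Longrightarrow> x \<noteq> 0 \<Longrightarrow> \<alpha> \<in> roots"
  by (auto simp: roots_def)

lemma root_dual: "\<alpha> \<in> roots \<Longrightarrow> \<alpha> \<in> dual"
  by (simp add: roots_def)

lemma root_vector:
  assumes "\<alpha> \<in> roots"
  obtains x where "x \<in> root_space \<alpha>" "x \<noteq> 0"
  using assms root_space_closed(1)[of \<alpha>] by (auto simp: roots_def)

lemma root_bracket: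
  assumes "\<alpha> \<in> roots" "\<beta> \<in> roots" "x \<in> root_space \<alpha>" "y \<in> root_space \<beta>" "bracket x y \<noteq> 0"
  shows "\<alpha> + \<beta> \<in> roots"
  using assms rootI root_space_bracket dual_add root_dual by meson

lemma nonisotropic_root: "\<alpha> \<in> nonisotropic_roots \<Longrightarrow> \<alpha> \<in> roots"
  by (simp add: nonisotropic_roots_def)

lemma nonisotropic_iff: "\<alpha> \<in> nonisotropic_roots \<longleftrightarrow> \<alpha> \<in> roots \<and> dual_form \<alpha> \<alpha> \<noteq> 0"
  by (auto simp: nonisotropic_roots_def isotropic_roots_def)

text \<open>
  Eigenvectors for distinct functionals are linearly independent: an element of \<open>H\<close> on which two of
  the functionals differ produces a shorter relation.
\<close>

lemma root_space_sum_zero: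
  assumes "finite A" "A \<subseteq> dual" "\<And>\<alpha>. \<alpha> \<in> A \<Longrightarrow> y \<alpha> \<in> root_space \<alpha>" "(\<Sum>\<alpha>\<in>A. y \<alpha>) = 0" "\<alpha> \<in> A"
  shows "y \<alpha> = 0"
  using assms
proof (induction A arbitrary: y \<alpha> rule: finite_induct)
  case empty
  then show ?case by simp
next
  case (insert \<beta> A)
  have other: "y \<gamma> = 0" if \<gamma>: "\<gamma> \<in> A" for \<gamma>
  proof -
    obtain k where k: "k \<in> H" "\<gamma> k \<noteq> \<beta> k"
      using dual_differ[of \<gamma> \<beta>] insert.prems(1) insert.hyps \<gamma> by (metis insert_subset subsetD)
    interpret ad: Vector_Spaces.linear scale scale "bracket k"
      by (rule linear_bracket)
    have "(\<Sum>\<delta>\<in>insert \<beta> A. scale (\<delta> k - \<beta> k) (y \<delta>))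
        = bracket k (\<Sum>\<delta>\<in>insert \<beta> A. y \<delta>) - scale (\<beta> k) (\<Sum>\<delta>\<in>insert \<beta> A. y \<delta>)"
      unfolding ad.sum scale_sum_right sum_subtractf[symmetric]
      by (intro sum.cong refl) (simp add: root_spaceD[OF insert.prems(2) k(1)] scale_left_diff_distrib)
    then have "(\<Sum>\<delta>\<in>A. scale (\<delta> k - \<beta> k) (y \<delta>)) = 0"
      using insert.prems(3) insert.hyps by simp
    then have "scale (\<gamma> k - \<beta> k) (y \<gamma>) = 0"
      using insert.IH[of "\<lambda>\<delta>. scale (\<delta> k - \<beta> k) (y \<delta>)" \<gamma>] insert.prems(1,2) \<gamma>
      by (auto intro: root_space_closed)
    then show ?thesis
      using k(2) by simp
  qed
  then have "y \<beta> = 0"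
    using insert.prems(3) insert.hyps by simp
  with other insert.prems(4) show ?case by auto
qed

lemma span_root_spaces_decomposition:
  assumes "x \<in> span (\<Union>\<alpha>\<in>S. root_space \<alpha>)"
  obtains A y where "finite A" "A \<subseteq> S" "\<And>\<alpha>. y \<alpha> \<in> root_space \<alpha>" "x = (\<Sum>\<alpha>\<in>A. y \<alpha>)"
proof -
  have "\<exists>A y. finite A \<and> A \<subseteq> S \<and> (\<forall>\<alpha>. y \<alpha> \<in> root_space \<alpha>) \<and> x = (\<Sum>\<alpha>\<in>A. y \<alpha>)"
    using assms
  proof (induction rule: span_induct_alt)
    case base
    show ?case
      by (rule exI[of _ "{}"], rule exI[of _ "\<lambda>_. 0"]) (simp add: root_space_closed)
  next
    case (step c u v)
    then obtain \<beta> A y where u: "\<beta> \<in> S" "u \<in> root_space \<beta>"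
      and A: "finite A" "A \<subseteq> S" "\<forall>\<alpha>. y \<alpha> \<in> root_space \<alpha>" "v = (\<Sum>\<alpha>\<in>A. y \<alpha>)"
      by auto
    let ?old = "\<lambda>\<alpha>. if \<alpha> \<in> A then y \<alpha> else 0"
    let ?y = "\<lambda>\<alpha>. (if \<alpha> = \<beta> then scale c u else 0) + ?old \<alpha>"
    have "(\<Sum>\<alpha>\<in>insert \<beta> A. ?old \<alpha>) = v"
      using A(1,4) by (auto simp: sum.insert_if intro!: sum.cong)
    moreover have "(\<Sum>\<alpha>\<in>insert \<beta> A. if \<alpha> = \<beta> then scale c u else 0) = scale c u"
      using A(1) by simp
    ultimately have "scale c u + v = (\<Sum>\<alpha>\<in>insert \<beta> A. ?y \<alpha>)"
      by (simp only: sum.distrib)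
    moreover have "\<forall>\<alpha>. ?y \<alpha> \<in> root_space \<alpha>"
      using A(3) u(2) by (auto intro: root_space_closed)
    ultimately show ?case
      using A(1,2) u(1) by (intro exI[of _ "insert \<beta> A"] exI[of _ ?y]) simp
  qed
  then show thesis using that by blast
qed

lemma root_space_inter_span:
  assumes "x \<in> span (\<Union>\<alpha>\<in>S. root_space \<alpha>)" "S \<subseteq> dual" "\<sigma> \<in> dual" "x \<in> root_space \<sigma>" "x \<noteq> 0"
  shows "\<sigma> \<in> S"
proof (rule ccontr)
  assume "\<sigma> \<notin> S"
  obtain A y where A: "finite A" "A \<subseteq> S" "\<And>\<alpha>. y \<alpha> \<in> root_space \<alpha>" "x = (\<Sum>\<alpha>\<in>A. y \<alpha>)"
    using span_root_spaces_decomposition[OF assms(1)] by metis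
  let ?y = "y(\<sigma> := - x)"
  have "\<sigma> \<notin> A"
    using A(2) \<open>\<sigma> \<notin> S\<close> by blast
  then have "(\<Sum>\<alpha>\<in>insert \<sigma> A. ?y \<alpha>) = - x + (\<Sum>\<alpha>\<in>A. y \<alpha>)"
    using A(1) by (auto intro!: sum.cong)
  then have "?y \<sigma> = 0"
    using A assms(2-4)
    by (intro root_space_sum_zero[of "insert \<sigma> A" ?y]) (auto intro: root_space_closed)
  then show False using assms(5) by simp
qed

end

context eala
begin

lemma subspace_H: "subspace H"
  using H_subalgebra by (simp add: subalgebra_def)

lemmas H_closed = subspace_0[OF subspace_H] subspace_add[OF subspace_H]
  subspace_diff[OF subspace_H] subspace_scale[OF subspace_H] subspace_neg[OF subspace_H]

lemma zero_root: "0 \<in> roots"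
  using H_nontrivial by (simp add: roots_def dual_zero root_space_zero)

lemma form_add_right: "form x (y + z) = form x y + form x z"
  by (simp add: form_sym[of x] form_add)

lemma form_scale_right: "form x (scale c y) = c * form x y"
  by (simp add: form_sym[of x] form_scale)

lemma form_minus: "form (- x) y = - form x y"
  using form_scale[of "- 1" x y] by simp

lemma form_diff: "form (x - y) z = form x z - form y z"
  using form_add[of x "- y" z] by (simp add: form_minus)

lemma form_zero [simp]: "form 0 x = 0" "form x 0 = 0"
  using form_scale[of 0 0 x] form_scale_right[of x 0 0] by simp_all

lemma form_root_spaces_orthogonal:
  assumes "\<alpha> \<in> dual" "\<beta> \<in> dual" "x \<in> root_space \<alpha>" "y \<in> root_space \<beta>" "\<beta> \<noteq> - \<alpha>"
  shows "form x y = 0"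
proof -
  obtain k where k: "k \<in> H" "\<beta> k \<noteq> (- \<alpha>) k"
    using dual_differ[OF assms(2) dual_minus[OF assms(1)] assms(5)] .
  have "\<alpha> k * form x y = - form (bracket x k) y"
    by (simp add: bracket_anticomm[of x k] root_spaceD[OF assms(3) k(1)] form_scale form_minus)
  also have "\<dots> = - (\<beta> k * form x y)"
    by (simp add: form_invariant root_spaceD[OF assms(4) k(1)] form_scale_right)
  finally have "(\<beta> k + \<alpha> k) * form x y = 0"
    by (simp add: algebra_simps)
  then show ?thesis
    using k(2) by (auto simp: eq_neg_iff_add_eq_0)
qed

text \<open>
  A vector that is orthogonal to the opposite root space is orthogonal to every root space.
\<close>

lemma form_pairing:
  assumes "\<alpha> \<in> dual" "x \<in> root_space \<alpha>" "x \<noteq> 0"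
  obtains y where "y \<in> root_space (- \<alpha>)" "form x y \<noteq> 0"
proof -
  have "\<exists>y\<in>root_space (- \<alpha>). form x y \<noteq> 0"
  proof (rule ccontr)
    assume "\<not> (\<exists>y\<in>root_space (- \<alpha>). form x y \<noteq> 0)"
    then have zero: "form x y = 0" if "y \<in> (\<Union>\<alpha>\<in>roots. root_space \<alpha>)" for y
      using that form_root_spaces_orthogonal[OF assms(1) root_dual assms(2)] by fast
    have "form x y = 0" if "y \<in> span (\<Union>\<alpha>\<in>roots. root_space \<alpha>)" for y
      using that
      by (induction rule: span_induct_alt) (simp_all add: form_add_right form_scale_right zero)
    then show False
      using form_nondegenerate[of x] assms(3) by (simp add: root_decomposition)
  qed
  then show thesis using that by blast
qed

lemma root_minus: "\<alpha> \<in> roots \<Longrightarrow> - \<alpha> \<in> roots"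
  by (metis dual_minus form_pairing form_zero(2) root_dual root_vector rootI)

lemma form_H_nondegenerate:
  assumes "k \<in> H" "\<And>h. h \<in> H \<Longrightarrow> form h k = 0"
  shows "k = 0"
  using form_pairing[OF dual_zero, of k] assms by (auto simp: root_space_zero form_sym[of k])

text \<open>
  A functional that vanishes wherever the functionals \<^term>\<open>\<lambda>x. form x b\<close>, \<open>b \<in> B\<close>, do is a combination
  of them. With a finite spanning set \<open>B\<close> of \<open>H\<close> this represents every functional on \<open>H\<close> by the form.
\<close>

lemma functional_by_form:
  assumes "finite B" "subspace S"
    and "\<And>x y. x \<in> S \<Longrightarrow> y \<in> S \<Longrightarrow> g (x + y) = g x + g y"
    and "\<And>c x. x \<in> S \<Longrightarrow> g (scale c x) = c * g x"
    and "\<And>x. x \<in> S \<Longrightarrow> (\<And>b. b \<in> B \<Longrightarrow> form x b = 0) \<Longrightarrow> g x = 0"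
  shows "\<exists>u\<in>span B. \<forall>x\<in>S. g x = form x u"
  using assms
proof (induction B arbitrary: S rule: finite_induct)
  case empty
  then show ?case by simp
next
  case (insert b B)
  let ?S = "{x \<in> S. form x b = 0}"
  have "subspace ?S"
    using insert.prems(1) by (auto simp: subspace_def form_add form_scale)
  then have "\<exists>u\<in>span B. \<forall>x\<in>?S. g x = form x u"
  proof (rule insert.IH)
    show "g x = 0" if "x \<in> ?S" "\<And>b. b \<in> B \<Longrightarrow> form x b = 0" for x
      using that insert.prems(4)[of x] by blast
  qed (use insert.prems in auto)
  then obtain u where u: "u \<in> span B" "\<And>x. x \<in> ?S \<Longrightarrow> g x = form x u"
    by blast
  have u': "u \<in> span (insert b B)"
    using u(1) span_mono[of B "insert b B"] by blast
  show ?case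
  proof (cases "\<forall>x\<in>S. form x b = 0")
    case True
    then show ?thesis using u(2) u' by auto
  next
    case False
    then obtain z where z: "z \<in> S" "form z b \<noteq> 0" by blast
    \<comment> \<open>\<open>S\<close> is spanned by the kernel of \<open>form _ b\<close> and \<open>z\<close>; this \<open>c\<close> makes both sides agree on \<open>z\<close>.\<close>
    define c where "c = (g z - form z u) / form z b"
    have "g x = form x (u + scale c b)" if x: "x \<in> S" for x
    proof -
      define a where "a = form x b / form z b"
      let ?x = "x + scale (- a) z"
      have S: "scale (- a) z \<in> S" "?x \<in> S"
        using insert.prems(1) x z(1) by (auto intro: subspace_add subspace_scale simp del: scale_minus_left)
      then have "?x \<in> ?S"
        using z(2) by (simp add: form_diff form_scale a_def)
      then have "g ?x = form ?x u"
        by (rule u(2))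
      moreover have "g ?x = g x - a * g z"
        using insert.prems(2)[OF x S(1)] insert.prems(3)[OF z(1), of "- a"] by simp
      moreover have "form ?x u = form x u - a * form z u"
        by (simp add: form_diff form_scale)
      ultimately have "g x - a * g z = form x u - a * form z u"
        by (simp only:)
      then have "g x = form x u + a * (g z - form z u)"
        by (simp add: algebra_simps)
      then show ?thesis
        by (simp add: form_add_right form_scale_right c_def a_def)
    qed
    moreover have "u + scale c b \<in> span (insert b B)"
      using u' by (auto intro: span_add span_scale span_base)
    ultimately show ?thesis by blast
  qed
qed

lemma t_unique:
  assumes "u \<in> H" "v \<in> H" "\<And>h. h \<in> H \<Longrightarrow> form h u = form h v"
  shows "u = v"
proof -
  have "form h (u - v) = 0" if "h \<in> H" for h
    using assms(3)[OF that] by (simp add: form_sym[of h] form_diff)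
  then show ?thesis
    using form_H_nondegenerate[of "u - v"] H_closed(3)[OF assms(1,2)] by simp
qed

lemma t_ex1:
  assumes "\<alpha> \<in> dual"
  shows "\<exists>!u. u \<in> H \<and> (\<forall>h\<in>H. \<alpha> h = form h u)"
proof -
  obtain B where B: "finite B" "span B = H"
    using H_finite_dim by blast
  have "\<exists>u\<in>span B. \<forall>x\<in>H. \<alpha> x = form x u"
  proof (rule functional_by_form[OF B(1) subspace_H])
    fix x assume x: "x \<in> H" "\<And>b. b \<in> B \<Longrightarrow> form x b = 0"
    have "form x h = 0" if "h \<in> span B" for h
      using that by (induction rule: span_induct_alt) (auto simp: form_add_right form_scale_right x(2))
    then have "x = 0"
      using form_H_nondegenerate[OF x(1)] B(2) form_sym[of x] by simp
    moreover have "\<alpha> 0 = 0"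
      using assms H_closed(1) unfolding dual_def by (auto dest!: bspec[of _ _ 0])
    ultimately show "\<alpha> x = 0" by simp
  qed (use assms in \<open>auto simp: dual_def\<close>)
  then show ?thesis
    using B(2) t_unique by (metis (no_types, lifting))
qed

lemma t_H: "\<alpha> \<in> dual \<Longrightarrow> t \<alpha> \<in> H"
  and form_t: "\<alpha> \<in> dual \<Longrightarrow> h \<in> H \<Longrightarrow> form h (t \<alpha>) = \<alpha> h"
  using theI'[OF t_ex1, of \<alpha>] unfolding t_def by auto

lemma t_eqI: "\<alpha> \<in> dual \<Longrightarrow> u \<in> H \<Longrightarrow> (\<And>h. h \<in> H \<Longrightarrow> form h u = \<alpha> h) \<Longrightarrow> t \<alpha> = u"
  by (rule t_unique) (auto simp: t_H form_t)

lemma t_add: "\<alpha> \<in> dual \<Longrightarrow> \<beta> \<in> dual \<Longrightarrow> t (\<alpha> + \<beta>) = t \<alpha> + t \<beta>"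
  by (rule t_eqI) (auto simp: dual_add H_closed t_H form_t form_add_right)

lemma t_cscale: "\<alpha> \<in> dual \<Longrightarrow> t (cscale c \<alpha>) = scale c (t \<alpha>)"
  by (rule t_eqI) (auto simp: dual_cscale H_closed t_H form_t form_scale_right, simp add: cscale_def)

lemma dual_form_eval: "\<alpha> \<in> dual \<Longrightarrow> \<beta> \<in> dual \<Longrightarrow> dual_form \<alpha> \<beta> = \<beta> (t \<alpha>)"
  by (simp add: dual_form_def form_t t_H)

lemma dual_form_sym: "dual_form \<alpha> \<beta> = dual_form \<beta> \<alpha>"
  by (simp add: dual_form_def form_sym)

lemma dual_form_add_right:
  "\<alpha> \<in> dual \<Longrightarrow> \<beta> \<in> dual \<Longrightarrow> \<gamma> \<in> dual \<Longrightarrow> dual_form \<alpha> (\<beta> + \<gamma>) = dual_form \<alpha> \<beta> + dual_form \<alpha> \<gamma>"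
  by (simp add: dual_form_def t_add form_add_right)

lemma dual_form_cscale_right:
  "\<beta> \<in> dual \<Longrightarrow> dual_form \<alpha> (cscale c \<beta>) = c * dual_form \<alpha> \<beta>"
  by (simp add: dual_form_def t_cscale form_scale_right)

lemma dual_form_minus_right: "\<beta> \<in> dual \<Longrightarrow> dual_form \<alpha> (- \<beta>) = - dual_form \<alpha> \<beta>"
  using dual_form_cscale_right[of \<beta> \<alpha> "- 1"] by (simp add: cscale_def fun_Compl_def)

lemma dual_form_diff_right:
  "\<alpha> \<in> dual \<Longrightarrow> \<beta> \<in> dual \<Longrightarrow> \<gamma> \<in> dual \<Longrightarrow> dual_form \<alpha> (\<beta> - \<gamma>) = dual_form \<alpha> \<beta> - dual_form \<alpha> \<gamma>"
  using dual_form_add_right[of \<alpha> \<beta> "- \<gamma>"] by (simp add: dual_minus dual_form_minus_right)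

lemma dual_form_minus_minus: "\<alpha> \<in> dual \<Longrightarrow> dual_form (- \<alpha>) (- \<alpha>) = dual_form \<alpha> \<alpha>"
  by (simp add: dual_form_minus_right dual_minus dual_form_sym[of "- \<alpha>" \<alpha>])

lemma bracket_t:
  "\<alpha> \<in> dual \<Longrightarrow> \<beta> \<in> dual \<Longrightarrow> x \<in> root_space \<beta> \<Longrightarrow> bracket (t \<alpha>) x = scale (dual_form \<alpha> \<beta>) x"
  by (simp add: root_spaceD t_H dual_form_eval)

lemma bracket_opposite:
  assumes "\<alpha> \<in> dual" "x \<in> root_space \<alpha>" "y \<in> root_space (- \<alpha>)"
  shows "bracket x y = scale (form x y) (t \<alpha>)"
proof (rule t_unique)
  show "bracket x y \<in> H"
    using root_space_bracket[OF assms(2,3)] by (simp add: root_space_zero)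
  show "form h (bracket x y) = form h (scale (form x y) (t \<alpha>))" if "h \<in> H" for h
    using that assms
    by (simp add: root_spaceD form_scale form_scale_right form_t flip: form_invariant)
qed (simp add: assms(1) t_H H_closed)

lemma nonisotropic_minus: "\<alpha> \<in> nonisotropic_roots \<Longrightarrow> - \<alpha> \<in> nonisotropic_roots"
  by (simp add: nonisotropic_iff root_minus dual_form_minus_minus root_dual)

lemma nonzero_pairing_scaled:
  assumes "\<alpha> \<in> dual" "e \<in> root_space \<alpha>" "e \<noteq> 0"
  obtains f where "f \<in> root_space (- \<alpha>)" "form e f = c"
proof -
  obtain y where y: "y \<in> root_space (- \<alpha>)" "form e y \<noteq> 0"
    using form_pairing[OF assms] .
  show thesis
    by (rule that[of "scale (c / form e y) y"]) (use y in \<open>auto simp: root_space_closed form_scale_right\<close>)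
qed

end

section \<open>Root strings of non-isotropic roots\<close>

context eala
begin

definition coroot :: "('e \<Rightarrow> complex) \<Rightarrow> 'e" where
  "coroot \<alpha> = scale (2 / dual_form \<alpha> \<alpha>) (t \<alpha>)"

lemma bracket_coroot:
  assumes "\<alpha> \<in> dual" "\<beta> \<in> dual" "x \<in> root_space \<beta>"
  shows "bracket (coroot \<alpha>) x = scale (2 * dual_form \<alpha> \<beta> / dual_form \<alpha> \<alpha>) x"
  using assms by (simp add: coroot_def bracket_scale_left bracket_t)

lemma sl2_triple:
  assumes "\<alpha> \<in> nonisotropic_roots" "e \<in> root_space \<alpha>" "f \<in> root_space (- \<alpha>)"
    and "form e f = 2 / dual_form \<alpha> \<alpha>"
  shows "sl2_action scale (bracket e) (bracket f) (bracket (coroot \<alpha>))"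
proof unfold_locales
  have \<alpha>: "\<alpha> \<in> dual" "dual_form \<alpha> \<alpha> \<noteq> 0"
    using assms(1) by (auto simp: nonisotropic_iff root_dual)
  have ef: "bracket e f = coroot \<alpha>"
    using bracket_opposite[OF \<alpha>(1) assms(2,3)] assms(4) by (simp add: coroot_def)
  have he: "bracket (coroot \<alpha>) e = scale 2 e"
    using bracket_coroot[OF \<alpha>(1) \<alpha>(1) assms(2)] \<alpha>(2) by simp
  have hf: "bracket (coroot \<alpha>) f = scale (- 2) f"
    using bracket_coroot[OF \<alpha>(1) dual_minus[OF \<alpha>(1)] assms(3)] \<alpha> by (simp add: dual_form_minus_right)
  show "bracket e (bracket f x) = bracket f (bracket e x) + bracket (coroot \<alpha>) x" for x
    using bracket_derivation[of e f x] by (simp add: ef add.commute)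
  show "bracket (coroot \<alpha>) (bracket e x) = scale (c + 2) (bracket e x)"
    if "bracket (coroot \<alpha>) x = scale c x" for c x
    using that bracket_derivation[of "coroot \<alpha>" e x]
    by (simp add: he bracket_scale_left bracket_scale_right scale_left_distrib add.commute)
  show "bracket (coroot \<alpha>) (bracket f x) = scale (c - 2) (bracket f x)"
    if "bracket (coroot \<alpha>) x = scale c x" for c x
    using that bracket_derivation[of "coroot \<alpha>" f x]
    by (simp add: hf bracket_scale_left bracket_scale_right scale_left_diff_distrib)
  show "\<exists>n. (bracket e ^^ n) x = 0" "\<exists>n. (bracket f ^^ n) x = 0" for x
    using ad_locally_nilpotent assms(1-3) nonisotropic_minus by blast+
qed (simp_all add: bracket_add_right bracket_scale_right)

text \<open>
  Otherwise some nonzero element of the root space would be orthogonal to, hence commute with, the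
  lowering operator of an sl2-triple: a lowest weight vector of positive weight 2.
\<close>

lemma root_space_one_dimensional:
  assumes "\<alpha> \<in> nonisotropic_roots" "x \<in> root_space \<alpha>" "x \<noteq> 0" "y \<in> root_space \<alpha>"
  obtains c where "y = scale c x"
proof -
  have \<alpha>: "\<alpha> \<in> dual" "dual_form \<alpha> \<alpha> \<noteq> 0"
    using assms(1) by (auto simp: nonisotropic_iff root_dual)
  obtain f where f: "f \<in> root_space (- \<alpha>)" "form x f = 2 / dual_form \<alpha> \<alpha>"
    using nonzero_pairing_scaled[OF \<alpha>(1) assms(2,3)] .
  interpret sl2_action scale "bracket x" "bracket f" "bracket (coroot \<alpha>)"
    by (rule sl2_triple[OF assms(1,2) f])
  \<comment> \<open>The multiple of \<open>x\<close> that makes the remainder orthogonal to \<open>f\<close>.\<close>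
  define z where "z = y - scale (form y f / form x f) x"
  have z: "z \<in> root_space \<alpha>"
    using assms(2,4) by (simp add: z_def root_space_closed)
  have "form z f = 0"
    using f(2) \<alpha>(2) by (simp add: z_def form_diff form_scale)
  then have "bracket f z = 0"
    using bracket_anticomm[of f z] bracket_opposite[OF \<alpha>(1) z f(1)] by simp
  moreover have "bracket (coroot \<alpha>) z = scale 2 z"
    using bracket_coroot[OF \<alpha>(1) \<alpha>(1) z] \<alpha>(2) by simp
  moreover have "(2 :: complex) \<noteq> - of_nat k" for k
    by (metis add.commute add_2_eq_Suc eq_neg_iff_add_eq_0 nat.distinct(1) of_nat_add of_nat_eq_0_iff of_nat_numeral)
  ultimately have "z = 0"
    using lowest_weight[of z 2] by blast
  then show thesis
    using that by (simp add: z_def)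
qed

lemma root_space_power:
  assumes "g \<in> root_space \<gamma>" "x \<in> root_space \<beta>"
  shows "(bracket g ^^ k) x \<in> root_space (\<beta> + zscale (int k) \<gamma>)"
proof (induction k)
  case 0
  then show ?case using assms(2) by simp
next
  case (Suc k)
  have "\<gamma> + (\<beta> + zscale (int k) \<gamma>) = \<beta> + zscale (int (Suc k)) \<gamma>"
    by (simp add: zscale_def fun_eq_iff algebra_simps)
  then show ?case
    using root_space_bracket[OF assms(1) Suc] by (simp only: funpow.simps o_apply)
qed

text \<open>
  By sl2-theory a nonzero vector of weight \<open>n\<close> is moved to weight \<open>- n\<close>, without being killed, by the
  \<open>\<bar>n\<bar>\<close>-th power of the lowering or raising operator.
\<close>

lemma reflected_root_vector:
  assumes "\<alpha> \<in> nonisotropic_roots" "\<beta> \<in> roots" "x \<in> root_space \<beta>" "x \<noteq> 0"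
  obtains n k \<gamma> g where "2 * dual_form \<alpha> \<beta> / dual_form \<alpha> \<alpha> = of_int n"
    "\<gamma> = \<alpha> \<or> \<gamma> = - \<alpha>" "g \<in> root_space \<gamma>" "(bracket g ^^ k) x \<noteq> 0"
    "zscale (int k) \<gamma> = - zscale n \<alpha>"
proof -
  let ?c = "\<lambda>\<alpha>. 2 * dual_form \<alpha> \<beta> / dual_form \<alpha> \<alpha>"
  have lower: "\<exists>n. ?c \<alpha> = of_int n \<and> (n \<ge> 0 \<longrightarrow>
      (\<exists>g\<in>root_space (- \<alpha>). (bracket g ^^ nat n) x \<noteq> 0))"
    if \<alpha>: "\<alpha> \<in> nonisotropic_roots" for \<alpha>
  proof -
    obtain e where e: "e \<in> root_space \<alpha>" "e \<noteq> 0"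
      using root_vector[OF nonisotropic_root[OF \<alpha>]] .
    have dual: "\<alpha> \<in> dual"
      using \<alpha> nonisotropic_root root_dual by blast
    obtain f where f: "f \<in> root_space (- \<alpha>)" "form e f = 2 / dual_form \<alpha> \<alpha>"
      using nonzero_pairing_scaled[OF dual e] .
    interpret sl2_action scale "bracket e" "bracket f" "bracket (coroot \<alpha>)"
      by (rule sl2_triple[OF \<alpha> e(1) f])
    have weight: "bracket (coroot \<alpha>) x = scale (?c \<alpha>) x"
      by (rule bracket_coroot[OF dual root_dual[OF assms(2)] assms(3)])
    obtain n where n: "?c \<alpha> = of_int n"
      using integral_weight[OF assms(4) weight] .
    have "(bracket f ^^ nat n) x \<noteq> 0" if "n \<ge> 0"
      using f_power_nonzero[OF assms(4), of "nat n" "nat n"] weight n that by simp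
    then show ?thesis
      using n f(1) by blast
  qed
  obtain n where n: "?c \<alpha> = of_int n"
    and down: "n \<ge> 0 \<Longrightarrow> \<exists>g\<in>root_space (- \<alpha>). (bracket g ^^ nat n) x \<noteq> 0"
    using lower[OF assms(1)] by blast
  have \<alpha>: "\<alpha> \<in> dual" "\<beta> \<in> dual"
    using assms(1,2) by (auto simp: nonisotropic_iff root_dual)
  have "dual_form (- \<alpha>) \<beta> = - dual_form \<alpha> \<beta>"
    unfolding dual_form_sym[of _ \<beta>] by (rule dual_form_minus_right[OF \<alpha>(1)])
  then have "?c (- \<alpha>) = - ?c \<alpha>"
    by (simp add: dual_form_minus_minus[OF \<alpha>(1)])
  then have up: "\<exists>g\<in>root_space \<alpha>. (bracket g ^^ nat (- n)) x \<noteq> 0" if "n < 0"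
    using lower[OF nonisotropic_minus[OF assms(1)]] that n
    by (auto simp: minus_equation_iff[of n] simp flip: of_int_minus)
  show thesis
  proof (cases "n \<ge> 0")
    case True
    then obtain g where "g \<in> root_space (- \<alpha>)" "(bracket g ^^ nat n) x \<noteq> 0"
      using down by blast
    then show thesis
      using True by (intro that[OF n, of "- \<alpha>" g "nat n"]) auto
  next
    case False
    then obtain g where "g \<in> root_space \<alpha>" "(bracket g ^^ nat (- n)) x \<noteq> 0"
      using up by auto
    then show thesis
      using False by (intro that[OF n, of \<alpha> g "nat (- n)"]) auto
  qed
qed

lemma dual_form_zscale_right:
  "\<beta> \<in> dual \<Longrightarrow> dual_form \<alpha> (zscale n \<beta>) = of_int n * dual_form \<alpha> \<beta>"
  using dual_form_cscale_right[of \<beta> \<alpha> "of_int n"] by (simp add: cscale_of_int)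

lemma cartan_integer:
  assumes "\<alpha> \<in> nonisotropic_roots" "\<beta> \<in> roots"
  obtains n where "2 * dual_form \<alpha> \<beta> / dual_form \<alpha> \<alpha> = of_int n"
proof -
  obtain x where "x \<in> root_space \<beta>" "x \<noteq> 0"
    using root_vector[OF assms(2)] .
  from reflected_root_vector[OF assms this] that show thesis by metis
qed

lemma reflection_root_eq:
  assumes "\<beta> \<in> dual" "2 * dual_form \<alpha> \<beta> / dual_form \<alpha> \<alpha> = of_int n"
  shows "reflection \<alpha> \<beta> = \<beta> - zscale n \<alpha>"
  using assms by (simp add: reflection_def cscale_of_int)

lemma reflection_dual: "\<alpha> \<in> dual \<Longrightarrow> \<beta> \<in> dual \<Longrightarrow> reflection \<alpha> \<beta> \<in> dual"
  by (simp add: reflection_def dual_diff dual_cscale)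

lemma reflection_involution:
  assumes "\<alpha> \<in> dual" "dual_form \<alpha> \<alpha> \<noteq> 0" "\<beta> \<in> dual"
  shows "reflection \<alpha> (reflection \<alpha> \<beta>) = \<beta>"
proof -
  let ?c = "2 * dual_form \<alpha> \<beta> / dual_form \<alpha> \<alpha>"
  have "dual_form \<alpha> (\<beta> - cscale ?c \<alpha>) = - dual_form \<alpha> \<beta>"
    using assms by (simp add: dual_form_diff_right dual_form_cscale_right dual_cscale)
  then have "reflection \<alpha> (reflection \<alpha> \<beta>) = \<beta> - cscale ?c \<alpha> - cscale (- ?c) \<alpha>"
    using reflection_dual[OF assms(1,3)] assms(3) by (simp add: reflection_def)
  then show ?thesis
    by (simp add: cscale_def fun_eq_iff)
qed

lemma dual_form_reflection:
  assumes "\<alpha> \<in> dual" "dual_form \<alpha> \<alpha> \<noteq> 0" "\<beta> \<in> dual"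
  shows "dual_form (reflection \<alpha> \<beta>) (reflection \<alpha> \<beta>) = dual_form \<beta> \<beta>"
proof -
  let ?c = "2 * dual_form \<alpha> \<beta> / dual_form \<alpha> \<alpha>"
  let ?w = "\<beta> - cscale ?c \<alpha>"
  have w: "?w \<in> dual"
    using assms by (simp add: dual_diff dual_cscale)
  have "dual_form ?w ?w = dual_form \<beta> ?w - ?c * dual_form \<alpha> ?w"
    using assms w dual_form_diff_right[of ?w \<beta> "cscale ?c \<alpha>"] dual_form_cscale_right[of \<alpha> ?w ?c]
    by (simp only: dual_form_sym[of ?w \<beta>] dual_form_sym[of ?w \<alpha>] dual_cscale)
  also have "\<dots> = dual_form \<beta> \<beta> - ?c * dual_form \<alpha> \<beta> - ?c * (dual_form \<alpha> \<beta> - ?c * dual_form \<alpha> \<alpha>)"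
    using assms by (simp add: dual_form_diff_right dual_form_cscale_right dual_cscale dual_form_sym[of \<beta> \<alpha>])
  also have "\<dots> = dual_form \<beta> \<beta>"
    using assms(2) by (simp add: field_simps)
  finally show ?thesis
    using assms(3) by (simp add: reflection_def)
qed

lemma reflection_root:
  assumes "\<alpha> \<in> nonisotropic_roots" "\<beta> \<in> roots"
  shows "reflection \<alpha> \<beta> \<in> roots"
proof -
  obtain x where x: "x \<in> root_space \<beta>" "x \<noteq> 0"
    using root_vector[OF assms(2)] .
  obtain n k \<gamma> g where n: "2 * dual_form \<alpha> \<beta> / dual_form \<alpha> \<alpha> = of_int n"
    and g: "g \<in> root_space \<gamma>" "(bracket g ^^ k) x \<noteq> 0" "zscale (int k) \<gamma> = - zscale n \<alpha>"
    using reflected_root_vector[OF assms x] by metis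
  have dual: "\<alpha> \<in> dual" "\<beta> \<in> dual"
    using assms by (auto simp: nonisotropic_iff root_dual)
  have "(bracket g ^^ k) x \<in> root_space (reflection \<alpha> \<beta>)"
    using root_space_power[OF g(1) x(1), of k] by (simp add: reflection_root_eq[OF dual(2) n] g(3))
  then show ?thesis
    using rootI g(2) reflection_dual[OF dual] by blast
qed

lemma reflection_nonisotropic:
  assumes "\<alpha> \<in> nonisotropic_roots" "\<beta> \<in> nonisotropic_roots"
  shows "reflection \<alpha> \<beta> \<in> nonisotropic_roots"
  using assms reflection_root[of \<alpha> \<beta>] dual_form_reflection[of \<alpha> \<beta>]
  by (simp add: nonisotropic_iff root_dual)

lemma reflection_Bij:
  assumes "\<alpha> \<in> nonisotropic_roots"
  shows "reflection \<alpha> \<in> Bij dual"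
proof -
  have \<alpha>: "\<alpha> \<in> dual" "dual_form \<alpha> \<alpha> \<noteq> 0"
    using assms by (auto simp: nonisotropic_iff root_dual)
  have "bij_betw (reflection \<alpha>) dual dual"
    by (rule bij_betw_byWitness[where f' = "reflection \<alpha>"])
       (use reflection_involution[OF \<alpha>] reflection_dual[OF \<alpha>(1)] in auto)
  then show ?thesis
    by (simp add: Bij_def) (simp add: reflection_def)
qed

text \<open>
  Reflections are involutions, so a set that the generators map into itself is also mapped into itself
  by their inverses.
\<close>

lemma refl_group_invariant:
  assumes "w \<in> refl_group P" "P \<subseteq> nonisotropic_roots" "S \<subseteq> dual"
    and invariant: "\<And>\<alpha> \<beta>. \<alpha> \<in> P \<Longrightarrow> \<beta> \<in> S \<Longrightarrow> reflection \<alpha> \<beta> \<in> S"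
    and "\<beta> \<in> S"
  shows "w \<beta> \<in> S"
proof -
  interpret group "BijGroup dual"
    by (rule group_BijGroup)
  have inv: "inv\<^bsub>BijGroup dual\<^esub> (reflection \<alpha>) = reflection \<alpha>" if "\<alpha> \<in> P" for \<alpha>
  proof (rule inv_equality)
    have \<alpha>: "\<alpha> \<in> nonisotropic_roots"
      using that assms(2) by blast
    then show bij: "reflection \<alpha> \<in> carrier (BijGroup dual)" "reflection \<alpha> \<in> carrier (BijGroup dual)"
      by (simp_all add: BijGroup_def reflection_Bij)
    show "reflection \<alpha> \<otimes>\<^bsub>BijGroup dual\<^esub> reflection \<alpha> = \<one>\<^bsub>BijGroup dual\<^esub>"
      using bij reflection_involution[of \<alpha>] \<alpha>
      by (auto simp: BijGroup_def compose_def nonisotropic_iff root_dual intro!: restrict_ext)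
  qed
  have "w \<in> Bij dual \<and> (\<forall>\<beta>\<in>S. w \<beta> \<in> S)"
    using assms(1) unfolding refl_group_def
  proof (induction rule: generate.induct)
    case one
    have "\<one>\<^bsub>BijGroup dual\<^esub> = (\<lambda>x\<in>dual. x)"
      by (simp add: BijGroup_def)
    then show ?case using id_Bij[of dual] assms(3) by (metis restrict_apply' subsetD)
  next
    case (incl h)
    then show ?case using assms(2) invariant reflection_Bij by blast
  next
    case (inv h)
    then show ?case using assms(2) invariant reflection_Bij \<open>\<And>\<alpha>. \<alpha> \<in> P \<Longrightarrow> _\<close> by force
  next
    case (eng h1 h2)
    then have "h1 \<otimes>\<^bsub>BijGroup dual\<^esub> h2 = compose dual h1 h2"
      by (simp add: BijGroup_def)
    then show ?case
      using eng.IH assms(3) compose_Bij compose_eq by (metis subsetD)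
  qed
  then show ?thesis using assms(5) by blast
qed

section \<open>Isotropic roots and the core\<close>

text \<open>
  If \<open>(\<gamma>, \<delta>) \<noteq> 0\<close> for an isotropic \<open>\<delta>\<close>, then root vectors for \<open>\<plusminus>\<delta>\<close> generate a Heisenberg algebra whose
  centre acts on the \<open>\<delta>\<close>-string through \<open>\<gamma>\<close> by a nonzero scalar, so that this string is infinite. But
  \<open>(\<gamma> + j \<delta>, \<gamma> + j \<delta>)\<close> grows with \<open>j\<close>, and the Cartan integers of \<open>\<delta>\<close> with respect to the roots
  \<open>\<gamma> + j \<delta>\<close> would be nonzero integers that tend to 0.
\<close>

lemma no_infinite_isotropic_string:
  assumes "\<delta> \<in> roots" "dual_form \<delta> \<delta> = 0" "\<gamma> \<in> dual" "\<And>j. \<gamma> + zscale (int j) \<delta> \<in> roots"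
  shows "dual_form \<gamma> \<delta> = 0"
proof (rule ccontr)
  assume d: "dual_form \<gamma> \<delta> \<noteq> 0"
  define z where "z = dual_form \<gamma> \<gamma> / (2 * dual_form \<gamma> \<delta>)"
  have \<delta>: "\<delta> \<in> dual"
    using assms(1) by (rule root_dual)
  \<comment> \<open>The Cartan integer of \<open>\<delta>\<close> with respect to \<open>\<gamma> + j \<delta>\<close> is \<open>1 / (z + j)\<close>; for this \<open>j\<close> its modulus is below 1.\<close>
  obtain j :: nat where j: "norm z + 1 < j"
    using reals_Archimedean2 by blast
  have "real j - norm z \<le> norm (z + of_nat j)"
    using norm_triangle_ineq2[of "of_nat j" "- z"] by (simp add: add.commute)
  then have large: "norm (z + of_nat j) > 1"
    using j by simp
  let ?\<beta> = "\<gamma> + zscale (int j) \<delta>"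
  have dual: "zscale (int j) \<delta> \<in> dual" "?\<beta> \<in> dual"
    using \<delta> assms(3) by (simp_all add: dual_add dual_zscale)
  have expand: "dual_form \<mu> ?\<beta> = dual_form \<mu> \<gamma> + of_nat j * dual_form \<mu> \<delta>" if "\<mu> \<in> dual" for \<mu>
    using that \<delta> assms(3) dual by (simp add: dual_form_add_right dual_form_zscale_right)
  have \<beta>\<gamma>: "dual_form ?\<beta> \<gamma> = dual_form \<gamma> \<gamma> + of_nat j * dual_form \<gamma> \<delta>"
    using expand[OF assms(3)] by (simp only: dual_form_sym[of ?\<beta> \<gamma>])
  have \<beta>\<delta>: "dual_form ?\<beta> \<delta> = dual_form \<gamma> \<delta>"
    using expand[OF \<delta>] assms(2) by (simp add: dual_form_sym[of ?\<beta> \<delta>] dual_form_sym[of \<delta> \<gamma>])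
  have "dual_form ?\<beta> ?\<beta> = dual_form ?\<beta> \<gamma> + of_nat j * dual_form ?\<beta> \<delta>"
    by (rule expand[OF dual(2)])
  also have "\<dots> = 2 * dual_form \<gamma> \<delta> * (z + of_nat j)"
    using d by (simp add: \<beta>\<gamma> \<beta>\<delta> z_def algebra_simps)
  finally have \<beta>\<beta>: "dual_form ?\<beta> ?\<beta> = 2 * dual_form \<gamma> \<delta> * (z + of_nat j)" .
  have nonzero: "z + of_nat j \<noteq> 0"
    using large by auto
  then have "?\<beta> \<in> nonisotropic_roots"
    using assms(4)[of j] d by (simp add: nonisotropic_iff \<beta>\<beta>)
  then obtain n where "2 * dual_form ?\<beta> \<delta> / dual_form ?\<beta> ?\<beta> = of_int n"
    using cartan_integer assms(1) by blast
  then have "of_int n = 1 / (z + of_nat j)"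
    unfolding \<beta>\<delta> \<beta>\<beta> using d by simp
  then have "of_int n * (z + of_nat j) = 1"
    using nonzero by simp
  then have n: "\<bar>real_of_int n\<bar> * norm (z + of_nat j) = 1"
    by (metis norm_mult norm_of_int norm_one)
  then have "n \<noteq> 0" by auto
  then have "1 \<le> \<bar>real_of_int n\<bar>" by linarith
  then have "1 * norm (z + of_nat j) \<le> 1"
    unfolding n[symmetric] by (rule mult_right_mono) simp
  then show False using large by simp
qed

lemma isotropic_orthogonal:
  assumes "\<delta> \<in> roots" "dual_form \<delta> \<delta> = 0" "\<beta> \<in> roots"
  shows "dual_form \<beta> \<delta> = 0"
proof (rule ccontr)
  assume c: "dual_form \<beta> \<delta> \<noteq> 0"
  have dual: "\<delta> \<in> dual" "\<beta> \<in> dual"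
    using assms by (auto simp: root_dual)
  obtain e where e: "e \<in> root_space \<delta>" "e \<noteq> 0"
    using root_vector[OF assms(1)] .
  obtain f where f: "f \<in> root_space (- \<delta>)" "form e f = 1"
    using nonzero_pairing_scaled[OF dual(1) e] .
  obtain x where x: "x \<in> root_space \<beta>" "x \<noteq> 0"
    using root_vector[OF assms(3)] .
  have string: "\<beta> + zscale n \<delta> \<in> dual" "dual_form \<delta> (\<beta> + zscale n \<delta>) = dual_form \<beta> \<delta>" for n
    using dual assms(2)
    by (simp_all add: dual_add dual_zscale dual_form_add_right dual_form_zscale_right dual_form_sym[of \<delta> \<beta>])
  have centre: "bracket e (bracket f y) = bracket f (bracket e y) + scale (dual_form \<beta> \<delta>) y"
    if "y \<in> root_space (\<beta> + zscale n \<delta>)" for y n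
    using bracket_derivation[of e f y] bracket_opposite[OF dual(1) e(1) f(1)] f(2)
      bracket_t[OF dual(1) string(1) that] string(2) by (simp add: add.commute)
  have "\<exists>k. (bracket e ^^ k) x = 0"
  proof (rule ccontr)
    assume "\<nexists>k. (bracket e ^^ k) x = 0"
    then have "\<beta> + zscale (int k) \<delta> \<in> roots" for k
      using rootI[OF string(1) root_space_power[OF e(1) x(1)]] by blast
    then show False
      using no_infinite_isotropic_string[OF assms(1,2) dual(2)] c by blast
  qed
  then obtain k where k: "(bracket e ^^ k) x = 0" "\<forall>i<k. (bracket e ^^ i) x \<noteq> 0"
    using exists_least_iff[of "\<lambda>k. (bracket e ^^ k) x = 0"] by blast
  then obtain m where m: "k = Suc m"
    using x(2) by (cases k) auto
  let ?y = "(bracket e ^^ m) x" and ?\<gamma> = "\<beta> + zscale (int m) \<delta>"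
  have y: "?y \<in> root_space ?\<gamma>" "?y \<noteq> 0" "bracket e ?y = 0"
    using root_space_power[OF e(1) x(1)] k by (auto simp: m)
  have space: "(bracket f ^^ j) ?y \<in> root_space (?\<gamma> + zscale (int j) (- \<delta>))" for j
    by (rule root_space_power[OF f(1) y(1)])
  have \<gamma>: "?\<gamma> + zscale (int j) (- \<delta>) = \<beta> + zscale (int m - int j) \<delta>" for j
    by (simp add: int_fun.scale_left_diff_distrib)
  have e_f: "bracket e ((bracket f ^^ Suc j) ?y) = scale (of_nat (Suc j) * dual_form \<beta> \<delta>) ((bracket f ^^ j) ?y)" for j
  proof (induction j)
    case 0
    then show ?case using centre[OF y(1)] y(3) by simp
  next
    case (Suc j)
    show ?case
      using centre[OF space[of "Suc j", unfolded \<gamma>]] Suc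
      by (simp add: bracket_scale_right algebra_simps flip: scale_left_distrib)
  qed
  have "(bracket f ^^ j) ?y \<noteq> 0" for j
  proof (induction j)
    case (Suc j)
    have "scale (of_nat (Suc j) * dual_form \<beta> \<delta>) ((bracket f ^^ j) ?y) \<noteq> 0"
      using Suc c by (simp only: scale_eq_0_iff mult_eq_0_iff of_nat_eq_0_iff nat.distinct simp_thms)
    then show ?case
      unfolding e_f[symmetric] using bracket_zero(1) by metis
  qed (use y(2) in simp)
  then have "?\<gamma> + zscale (int j) (- \<delta>) \<in> roots" for j
    using rootI[OF _ space] string(1) unfolding \<gamma> by blast
  moreover have "dual_form (- \<delta>) (- \<delta>) = 0"
    using assms(2) dual_form_minus_minus[OF dual(1)] by simp
  ultimately have "dual_form ?\<gamma> (- \<delta>) = 0"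
    by (rule no_infinite_isotropic_string[OF root_minus[OF assms(1)] _ string(1), rotated])
  then show False
    using c string(2)[of "int m"] by (simp only: dual_form_minus_right[OF dual(1)] dual_form_sym[of ?\<gamma> \<delta>] neg_equal_0_iff_equal)
qed

lemma subalgebra_core: "subalgebra core"
  unfolding core_def by (rule subalgebra_hull)

lemma root_space_core: "\<alpha> \<in> nonisotropic_roots \<Longrightarrow> root_space \<alpha> \<subseteq> core"
  unfolding core_def by (blast intro: hull_inc)

lemma core_induct:
  assumes "subalgebra T" "\<And>\<alpha>. \<alpha> \<in> nonisotropic_roots \<Longrightarrow> root_space \<alpha> \<subseteq> T"
  shows "core \<subseteq> T"
  unfolding core_def using assms by (intro hull_minimal) auto

text \<open>
  By orthogonality, \<open>\<sigma> + \<alpha>\<close> is non-isotropic if \<open>\<sigma>\<close> is isotropic and \<open>\<alpha>\<close> is not.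
\<close>

lemma core_absorbs:
  assumes "\<sigma> \<in> roots" "\<alpha> \<in> nonisotropic_roots" "x \<in> root_space \<sigma>" "y \<in> root_space \<alpha>"
  shows "bracket x y \<in> core"
    and "dual_form \<sigma> \<sigma> = 0 \<Longrightarrow> bracket x y \<noteq> 0 \<Longrightarrow> \<sigma> + \<alpha> \<in> nonisotropic_roots"
proof -
  have dual: "\<sigma> \<in> dual" "\<alpha> \<in> dual"
    using assms(1,2) by (auto simp: nonisotropic_iff root_dual)
  show sum: "\<sigma> + \<alpha> \<in> nonisotropic_roots" if iso: "dual_form \<sigma> \<sigma> = 0" and nz: "bracket x y \<noteq> 0"
  proof -
    have root: "\<sigma> + \<alpha> \<in> roots"
      using root_bracket[OF assms(1) _ assms(3,4) nz] assms(2) nonisotropic_root by blast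
    have "dual_form (\<sigma> + \<alpha>) \<sigma> = 0" "dual_form \<alpha> \<sigma> = 0"
      using isotropic_orthogonal[OF assms(1) iso] root assms(2) nonisotropic_root by blast+
    then have "dual_form (\<sigma> + \<alpha>) (\<sigma> + \<alpha>) = dual_form \<alpha> \<alpha>"
      using dual dual_add[OF dual] by (simp add: dual_form_add_right dual_form_sym[of "\<sigma> + \<alpha>" \<alpha>])
    then show ?thesis
      using root assms(2) by (simp add: nonisotropic_iff)
  qed
  show "bracket x y \<in> core"
  proof (cases "dual_form \<sigma> \<sigma> = 0 \<and> bracket x y \<noteq> 0")
    case True
    then show ?thesis
      using sum root_space_core root_space_bracket[OF assms(3,4)] by blast
  next
    case False
    then show ?thesis
      using assms root_space_core[of \<sigma>] root_space_core[of \<alpha>] subalgebra_core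
      by (auto simp: subalgebra_def nonisotropic_iff subspace_0)
  qed
qed

lemma centralizer_in_core:
  assumes "\<And>\<alpha> y. \<alpha> \<in> nonisotropic_roots \<Longrightarrow> y \<in> root_space \<alpha> \<Longrightarrow> bracket x y = 0"
  shows "x \<in> core"
proof -
  have "subalgebra {y. bracket x y = 0}"
    by (auto simp: subalgebra_def subspace_def bracket_add_right bracket_scale_right
        bracket_derivation[of x])
  then have "core \<subseteq> {y. bracket x y = 0}"
    using assms by (intro core_induct) auto
  then show ?thesis
    using tame by blast
qed

text \<open>
  Tameness: a root vector either moves some generator of the core or lies in the core itself, whose
  weights are sums of non-isotropic roots.
\<close>

lemma roots_in_nonisotropic_span: "roots \<subseteq> int_fun.span nonisotropic_roots"
proof
  fix \<sigma> assume \<sigma>: "\<sigma> \<in> roots"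
  let ?S = "int_fun.span nonisotropic_roots \<inter> dual"
  show "\<sigma> \<in> int_fun.span nonisotropic_roots"
  proof (cases "dual_form \<sigma> \<sigma> = 0")
    case False
    then show ?thesis
      using \<sigma> by (auto simp: nonisotropic_iff intro: int_fun.span_base)
  next
    case True
    obtain x where x: "x \<in> root_space \<sigma>" "x \<noteq> 0"
      using root_vector[OF \<sigma>] .
    show ?thesis
    proof (cases "\<exists>\<alpha>\<in>nonisotropic_roots. \<exists>y\<in>root_space \<alpha>. bracket x y \<noteq> 0")
      case True
      then obtain \<alpha> where "\<alpha> \<in> nonisotropic_roots" "\<sigma> + \<alpha> \<in> nonisotropic_roots"
        using core_absorbs(2)[OF \<sigma> _ x(1)] \<open>dual_form \<sigma> \<sigma> = 0\<close> by blast
      then have "\<sigma> + \<alpha> - \<alpha> \<in> int_fun.span nonisotropic_roots"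
        by (intro int_fun.span_diff int_fun.span_base)
      then show ?thesis by simp
    next
      case False
      then have "x \<in> core"
        by (intro centralizer_in_core) blast
      moreover have "core \<subseteq> span (\<Union>\<beta>\<in>?S. root_space \<beta>)"
      proof (rule core_induct)
        show "subalgebra (span (\<Union>\<beta>\<in>?S. root_space \<beta>))"
        proof (rule subalgebra_span)
          fix u v assume "u \<in> (\<Union>\<beta>\<in>?S. root_space \<beta>)" "v \<in> (\<Union>\<beta>\<in>?S. root_space \<beta>)"
          then obtain \<beta> \<gamma> where "\<beta> \<in> ?S" "\<gamma> \<in> ?S" "u \<in> root_space \<beta>" "v \<in> root_space \<gamma>"
            by blast
          then have "\<beta> + \<gamma> \<in> ?S" "bracket u v \<in> root_space (\<beta> + \<gamma>)"
            by (simp_all add: int_fun.span_add dual_add root_space_bracket)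
          then show "bracket u v \<in> span (\<Union>\<beta>\<in>?S. root_space \<beta>)"
            by (blast intro: span_base)
        qed
        show "root_space \<alpha> \<subseteq> span (\<Union>\<beta>\<in>?S. root_space \<beta>)" if "\<alpha> \<in> nonisotropic_roots" for \<alpha>
        proof -
          have "\<alpha> \<in> ?S"
            using that by (simp add: int_fun.span_base root_dual nonisotropic_root)
          then show ?thesis
            by (blast intro: span_base)
        qed
      qed
      ultimately show ?thesis
        using root_space_inter_span[of x ?S \<sigma>] x root_dual[OF \<sigma>] by blast
    qed
  qed
qed

text \<open>
  By integrality of the Cartan integers, reflections do not leave the lattice spanned by \<open>P\<close>.
\<close>

lemma span_reflectable:
  assumes "reflectable P"
  shows "int_fun.span P = int_fun.span roots"
proof (rule subset_antisym)
  have P: "P \<subseteq> nonisotropic_roots"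
    using assms by (simp add: reflectable_def)
  then show "int_fun.span P \<subseteq> int_fun.span roots"
    by (intro int_fun.span_mono) (auto simp: nonisotropic_iff)
  let ?S = "nonisotropic_roots \<inter> int_fun.span P"
  have invariant: "reflection \<alpha> \<beta> \<in> ?S" if \<alpha>\<beta>: "\<alpha> \<in> P" "\<beta> \<in> ?S" for \<alpha> \<beta>
  proof -
    have \<beta>: "\<beta> \<in> roots"
      using that(2) by (simp add: nonisotropic_iff)
    obtain n where n: "2 * dual_form \<alpha> \<beta> / dual_form \<alpha> \<alpha> = of_int n"
      using cartan_integer[OF subsetD[OF P \<alpha>\<beta>(1)] \<beta>] .
    have "reflection \<alpha> \<beta> \<in> int_fun.span P"
      unfolding reflection_root_eq[OF root_dual[OF \<beta>] n]
      using that by (auto intro: int_fun.span_diff int_fun.span_scale int_fun.span_base)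
    then show ?thesis
      using reflection_nonisotropic that P by blast
  qed
  have "P \<subseteq> ?S" "?S \<subseteq> dual"
    using P int_fun.span_superset[of P] by (auto simp: nonisotropic_iff root_dual)
  then have "w \<beta> \<in> ?S" if "w \<in> refl_group P" "\<beta> \<in> P" for w \<beta>
    using that by (intro refl_group_invariant[OF that(1) P _ invariant]) auto
  moreover have "nonisotropic_roots = {w \<beta> |w \<beta>. w \<in> refl_group P \<and> \<beta> \<in> P}"
    using assms by (simp add: reflectable_def)
  ultimately have "nonisotropic_roots \<subseteq> int_fun.span P"
    by auto
  then have "int_fun.span nonisotropic_roots \<subseteq> int_fun.span P"
    by (simp add: int_fun.span_minimal)
  then show "int_fun.span roots \<subseteq> int_fun.span P"
    using roots_in_nonisotropic_span by (intro int_fun.span_minimal) auto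
qed

end

section \<open>Reflectable bases of index zero\<close>

definition qscale :: "rat \<Rightarrow> ('e \<Rightarrow> complex) \<Rightarrow> ('e \<Rightarrow> complex)" where
  "qscale q \<alpha> = (\<lambda>x. of_rat q * \<alpha> x)"

global_interpretation rat_fun: vector_space "qscale :: rat \<Rightarrow> ('e \<Rightarrow> complex) \<Rightarrow> _"
  by unfold_locales (auto simp: qscale_def fun_eq_iff algebra_simps of_rat_add of_rat_mult)

lemma qscale_of_int: "qscale (of_int n) = zscale n"
  by (simp add: qscale_def zscale_def fun_eq_iff)

lemma common_denominator:
  fixes u :: "'a \<Rightarrow> rat"
  assumes "finite T"
  shows "\<exists>d n. d \<noteq> 0 \<and> (\<forall>v\<in>T. of_int d * u v = of_int (n v))"
  using assms
proof (induction T rule: finite_induct)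
  case empty
  then show ?case by (auto intro: exI[of _ 1])
next
  case (insert v T)
  then obtain d n where d: "d \<noteq> 0" "\<forall>w\<in>T. of_int d * u w = of_int (n w)" by blast
  obtain a b where ab: "u v = Fract a b" "b > 0"
    by (cases "u v") auto
  have b: "of_int b * u v = of_int a"
    using ab by (simp add: Fract_of_int_quotient)
  have "of_int (b * d) * u w = of_int (if w = v then d * a else b * n w)" if "w \<in> insert v T" for w
  proof (cases "w = v")
    case True
    have "of_int (b * d) * u v = of_int (d * a)"
      unfolding of_int_mult b[symmetric] by simp
    then show ?thesis
      using True by simp
  next
    case False
    then have "of_int d * u w = of_int (n w)"
      using d(2) that by blast
    then show ?thesis
      using False by (simp add: mult.assoc)
  qed
  then show ?case
    using d(1) ab(2) by (intro exI[of _ "b * d"] exI[of _ "\<lambda>w. if w = v then d * a else b * n w"]) auto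
qed

text \<open>
  Ranks of lattices are compared in the surrounding rational vector space, where the exchange lemma
  holds.
\<close>

lemma rat_independent_iff: "rat_fun.independent B \<longleftrightarrow> int_fun.independent B"
proof
  assume B: "rat_fun.independent B"
  show "int_fun.independent B"
    unfolding int_fun.independent_explicit_module
  proof (intro allI impI)
    fix T u v
    assume T: "finite T" "T \<subseteq> B" "(\<Sum>w\<in>T. zscale (u w) w) = 0" "v \<in> T"
    then have "(of_int (u v) :: rat) = 0"
      using rat_fun.independentD[OF B T(1,2), of "\<lambda>w. of_int (u w)" v] by (simp add: qscale_of_int)
    then show "u v = 0" by simp
  qed
next
  assume B: "int_fun.independent B"
  show "rat_fun.independent B"
    unfolding rat_fun.independent_explicit_module
  proof (intro allI impI)
    fix T u v
    assume T: "finite T" "T \<subseteq> B" "(\<Sum>w\<in>T. qscale (u w) w) = 0" "v \<in> T"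
    obtain d n where d: "d \<noteq> 0" "\<forall>w\<in>T. of_int d * u w = of_int (n w)"
      using common_denominator[OF T(1)] by blast
    have "(\<Sum>w\<in>T. zscale (n w) w) = (\<Sum>w\<in>T. qscale (of_int d) (qscale (u w) w))"
    proof (rule sum.cong[OF refl])
      fix w assume "w \<in> T"
      then have "of_int d * u w = of_int (n w)"
        using d(2) by blast
      then show "zscale (n w) w = qscale (of_int d) (qscale (u w) w)"
        by (simp only: rat_fun.scale_scale flip: qscale_of_int)
    qed
    also have "\<dots> = 0"
      unfolding rat_fun.scale_sum_right[symmetric] T(3) by simp
    finally have "n v = 0"
      by (rule int_fun.independentD[OF B T(1,2) _ T(4)])
    then show "u v = 0"
      using d T(4) by (metis mult_eq_0_iff of_int_0 of_int_0_eq_iff)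
  qed
qed

lemma int_span_subset_rat_span: "int_fun.span S \<subseteq> rat_fun.span S"
proof
  fix x assume "x \<in> int_fun.span S"
  then show "x \<in> rat_fun.span S"
  proof (induction rule: int_fun.span_induct_alt)
    case (step c u v)
    then have "qscale (of_int c) u + v \<in> rat_fun.span S"
      by (simp add: rat_fun.span_add rat_fun.span_scale rat_fun.span_base)
    then show ?case by (simp only: qscale_of_int)
  qed (rule rat_fun.span_zero)
qed

lemma int_basis_card:
  assumes "finite B" "int_fun.independent B" "int_fun.independent C" "int_fun.span B = int_fun.span C"
  shows "card C = card B"
proof -
  have C: "C \<subseteq> rat_fun.span B" and B: "B \<subseteq> rat_fun.span C"
    using assms(4) int_fun.span_superset int_span_subset_rat_span by blast+
  have "finite C" "card C \<le> card B"
    using rat_fun.independent_span_bound[OF assms(1) _ C] assms(3) by (auto simp: rat_independent_iff)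
  then show ?thesis
    using rat_fun.independent_span_bound[OF _ _ B] assms(2) by (simp add: rat_independent_iff)
qed

text \<open>
  A rationally independent subset of \<open>P\<close> with the same rational span already has at least as many
  elements as \<open>B\<close>, so it is all of \<open>P\<close>.
\<close>

lemma int_spanning_set_independent:
  assumes "finite B" "int_fun.independent B" "finite P" "int_fun.span P = int_fun.span B" "card P = card B"
  shows "int_fun.independent P"
proof -
  obtain Q where Q: "Q \<subseteq> P" "rat_fun.independent Q" "P \<subseteq> rat_fun.span Q"
    using rat_fun.maximal_independent_subset .
  have "B \<subseteq> rat_fun.span P"
    using assms(4) int_fun.span_superset[of B] int_span_subset_rat_span[of P] by blast
  also have "\<dots> \<subseteq> rat_fun.span Q"
    using Q(3) by (simp add: rat_fun.span_minimal)
  finally have "card B \<le> card Q"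
    using rat_fun.independent_span_bound[of Q B] Q(1) assms(2,3) finite_subset
    by (auto simp: rat_independent_iff)
  then have "Q = P"
    using card_subset_eq[OF assms(3) Q(1)] card_mono[OF assms(3) Q(1)] assms(5) by simp
  then show ?thesis
    using Q(2) by (simp add: rat_independent_iff)
qed

context eala
begin

text \<open>
  Index zero says that a smallest reflectable base has as many elements as a basis of the root lattice,
  which it spans. The index is finite, so the infimum that defines it is attained.
\<close>

lemma reflectable_lattice_basis:
  assumes "root_index = 0"
  obtains P where "reflectable P" "finite P" "int_fun.independent P"
proof -
  let ?A = "(\<lambda>P. enat (card P)) ` {P. reflectable_base P \<and> finite P}"
  have "refl_number = enat lattice_rank"
    using assms unfolding root_index_def by (cases refl_number) auto
  moreover have "refl_number = Inf ?A"
    by (simp add: refl_number_def)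
  moreover have "?A \<noteq> {}"
  proof
    assume "?A = {}"
    then have "Inf ?A = \<infinity>" by (simp only: Inf_enat_def if_True refl)
    then show False using calculation by simp
  qed
  then have "Inf ?A \<in> ?A"
    by (auto simp: Inf_enat_def intro: LeastI)
  ultimately have "enat lattice_rank \<in> ?A" by simp
  then obtain P where P: "reflectable P" "finite P" "card P = lattice_rank"
    by (auto simp: reflectable_base_def)
  obtain B where B: "finite B" "lattice_basis B"
    using lattice_free by blast
  have "lattice_rank = card B"
    unfolding lattice_rank_def
  proof (rule the_equality)
    show "\<exists>C. finite C \<and> card C = card B \<and> lattice_basis C"
      using B by blast
    show "n = card B" if n: "\<exists>C. finite C \<and> card C = n \<and> lattice_basis C" for n
    proof -
      obtain C where C: "card C = n" "lattice_basis C"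
        using n by blast
      then show ?thesis
        using int_basis_card[OF B(1), of C] B(2) unfolding lattice_basis_def by (metis (no_types))
    qed
  qed
  then have "int_fun.independent P"
    using int_spanning_set_independent[OF B(1) _ P(2)] B(2) P(3) span_reflectable[OF P(1)]
    by (simp add: lattice_basis_def)
  then show thesis
    using that P by blast
qed

end

section \<open>Diagonal maps and characters\<close>

context eala
begin

lemma linear_eq_on_root_spaces:
  assumes "Vector_Spaces.linear scale scale f" "Vector_Spaces.linear scale scale g"
    and "\<And>\<alpha> x. \<alpha> \<in> roots \<Longrightarrow> x \<in> root_space \<alpha> \<Longrightarrow> f x = g x"
  shows "f = g"
proof
  interpret f: Vector_Spaces.linear scale scale f by fact
  interpret g: Vector_Spaces.linear scale scale g by fact
  fix x
  have "x \<in> span (\<Union>\<alpha>\<in>roots. root_space \<alpha>)"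
    by (simp add: root_decomposition)
  then show "f x = g x"
  proof (induction rule: span_induct_alt)
    case (step c u v)
    then show ?case
      using assms(3) by (auto simp: f.add g.add f.scale g.scale)
  qed (simp add: f.zero g.zero)
qed

lemma bracket_preserving_on_root_spaces:
  assumes "Vector_Spaces.linear scale scale f"
    and "\<And>\<alpha> \<beta> x y. \<alpha> \<in> roots \<Longrightarrow> \<beta> \<in> roots \<Longrightarrow> x \<in> root_space \<alpha> \<Longrightarrow> y \<in> root_space \<beta> \<Longrightarrow>
      f (bracket x y) = bracket (f x) (f y)"
  shows "f (bracket x y) = bracket (f x) (f y)"
proof -
  interpret f: Vector_Spaces.linear scale scale f by fact
  let ?R = "\<Union>\<alpha>\<in>roots. root_space \<alpha>"
  have left: "f (bracket u y) = bracket (f u) (f y)" if u: "u \<in> ?R" for u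
  proof -
    have "y \<in> span ?R"
      by (simp add: root_decomposition)
    then show ?thesis
    proof (induction rule: span_induct_alt)
      case (step c v w)
      then have "f (bracket u v) = bracket (f u) (f v)"
        using u assms(2) by blast
      with step show ?case
        by (simp add: bracket_add_right bracket_scale_right f.add f.scale)
    qed (simp add: f.zero)
  qed
  have "x \<in> span ?R"
    by (simp add: root_decomposition)
  then show ?thesis
  proof (induction rule: span_induct_alt)
    case (step c v w)
    then show ?case
      using left[OF step.hyps(1)] by (simp add: bracket_add_left bracket_scale_left f.add f.scale)
  qed (simp add: f.zero)
qed

text \<open>
  A basis of root vectors defines the map; that it is a scalar on each full root space is the linear
  independence of the root spaces.
\<close>

lemma diagonal_map_exists:
  "\<exists>f. Vector_Spaces.linear scale scale f \<and> (\<forall>\<alpha>\<in>roots. \<forall>x\<in>root_space \<alpha>. f x = scale (c \<alpha>) x)"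
proof -
  interpret vector_space_pair scale scale
    by unfold_locales
  let ?R = "\<Union>\<alpha>\<in>roots. root_space \<alpha>"
  obtain B where B: "B \<subseteq> ?R" "independent B" "?R \<subseteq> span B"
    using maximal_independent_subset .
  then obtain rt where rt: "\<And>b. b \<in> B \<Longrightarrow> rt b \<in> roots \<and> b \<in> root_space (rt b)"
    by (metis UN_E subsetD)
  let ?f = "construct B (\<lambda>b. scale (c (rt b)) b)"
  interpret f: Vector_Spaces.linear scale scale ?f
    by (rule linear_construct[OF B(2)])
  have "?f x = scale (c \<alpha>) x" if \<alpha>: "\<alpha> \<in> roots" "x \<in> root_space \<alpha>" for \<alpha> x
  proof -
    have "x \<in> span B"
      using \<alpha> B(3) by blast
    then obtain T r where T: "finite T" "T \<subseteq> B" "x = (\<Sum>b\<in>T. scale (r b) b)"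
      unfolding span_explicit by blast
    \<comment> \<open>The components of \<open>x\<close>, all but one of which must vanish.\<close>
    define y where "y \<beta> = (\<Sum>b | b \<in> T \<and> rt b = \<beta>. scale (r b) b)" for \<beta>
    let ?A = "insert \<alpha> (rt ` T)" and ?z = "\<lambda>\<beta>. y \<beta> - (if \<beta> = \<alpha> then x else 0)"
    have y: "y \<beta> \<in> root_space \<beta>" for \<beta>
      unfolding y_def using T(2) rt by (intro root_space_closed) auto
    have "(\<Sum>\<beta>\<in>?A. y \<beta>) = x"
      unfolding y_def T(3) using T(1) by (intro sum.group) auto
    then have "(\<Sum>\<beta>\<in>?A. ?z \<beta>) = 0"
      unfolding sum_subtractf using T(1) by simp
    moreover have "?A \<subseteq> dual"
      using \<alpha>(1) T(2) rt root_dual by blast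
    ultimately have "?z \<alpha> = 0"
      using T(1) y \<alpha>(2) by (intro root_space_sum_zero[of ?A ?z \<alpha>]) (auto intro: root_space_closed)
    then have x: "x = y \<alpha>" by simp
    have "?f (y \<alpha>) = (\<Sum>b | b \<in> T \<and> rt b = \<alpha>. scale (c \<alpha>) (scale (r b) b))"
      unfolding y_def f.sum using T(2)
      by (intro sum.cong refl) (auto simp: f.scale construct_basis[OF B(2)] mult.commute)
    then show ?thesis
      unfolding x by (simp add: y_def scale_sum_right)
  qed
  then show ?thesis
    using f.linear_axioms by blast
qed

definition diagonal :: "(('e \<Rightarrow> complex) \<Rightarrow> complex) \<Rightarrow> 'e \<Rightarrow> 'e" where
  "diagonal c = (SOME f. Vector_Spaces.linear scale scale f \<and>
     (\<forall>\<alpha>\<in>roots. \<forall>x\<in>root_space \<alpha>. f x = scale (c \<alpha>) x))"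

lemma linear_diagonal: "Vector_Spaces.linear scale scale (diagonal c)"
  and diagonal_root_space: "\<alpha> \<in> roots \<Longrightarrow> x \<in> root_space \<alpha> \<Longrightarrow> diagonal c x = scale (c \<alpha>) x"
  using someI_ex[OF diagonal_map_exists[of c]] unfolding diagonal_def by auto

lemma diagonal_compose:
  assumes "\<And>\<alpha>. \<alpha> \<in> roots \<Longrightarrow> b \<alpha> = c \<alpha> * d \<alpha>"
  shows "diagonal c \<circ> diagonal d = diagonal b"
proof (rule linear_eq_on_root_spaces)
  show "Vector_Spaces.linear scale scale (diagonal c \<circ> diagonal d)"
    using Vector_Spaces.linear_compose linear_diagonal by blast
qed (auto simp: diagonal_root_space root_space_closed assms mult.commute linear_diagonal)

lemma diagonal_one:
  assumes "\<And>\<alpha>. \<alpha> \<in> roots \<Longrightarrow> c \<alpha> = 1"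
  shows "diagonal c = id"
  by (rule linear_eq_on_root_spaces) (auto simp: diagonal_root_space assms linear_diagonal linear_id)

lemma diagonal_power: "diagonal c ^^ m = diagonal (\<lambda>\<alpha>. c \<alpha> ^ m)"
proof (induction m)
  case 0
  then show ?case using diagonal_one by simp
next
  case (Suc m)
  then show ?case using diagonal_compose[of "\<lambda>\<alpha>. c \<alpha> ^ Suc m"] by simp
qed

lemma diagonal_inject:
  assumes "diagonal c = diagonal d" "\<alpha> \<in> roots"
  shows "c \<alpha> = d \<alpha>"
proof -
  obtain x where x: "x \<in> root_space \<alpha>" "x \<noteq> 0"
    using root_vector[OF assms(2)] .
  then show ?thesis
    using diagonal_root_space[OF assms(2) x(1), of c] diagonal_root_space[OF assms(2) x(1), of d] assms(1)
    by simp
qed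

lemma Cartan_iff:
  "\<Psi> \<in> carrier Cartan_group \<longleftrightarrow> Vector_Spaces.linear scale scale \<Psi> \<and> bij \<Psi> \<and>
     (\<forall>x y. \<Psi> (bracket x y) = bracket (\<Psi> x) (\<Psi> y)) \<and> (\<forall>h\<in>H. \<Psi> h = h)"
  by (auto simp: Cartan_group_def Aut_def)

lemma character_iff:
  "\<psi> \<in> carrier character_group \<longleftrightarrow> \<psi> \<in> roots \<rightarrow>\<^sub>E (UNIV - {0}) \<and>
     (\<forall>\<alpha>\<in>roots. \<forall>\<beta>\<in>roots. \<alpha> + \<beta> \<in> roots \<longrightarrow> \<psi> (\<alpha> + \<beta>) = \<psi> \<alpha> * \<psi> \<beta>)"
  by (simp add: character_group_def)

lemma character_nonzero: "\<psi> \<in> carrier character_group \<Longrightarrow> \<alpha> \<in> roots \<Longrightarrow> \<psi> \<alpha> \<noteq> 0"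
  by (auto simp: character_iff)

lemma character_zero: "\<psi> \<in> carrier character_group \<Longrightarrow> \<psi> 0 = 1"
  using zero_root character_nonzero[of \<psi> 0] by (force simp: character_iff)

lemma character_minus:
  assumes "\<psi> \<in> carrier character_group" "\<alpha> \<in> roots"
  shows "\<psi> \<alpha> * \<psi> (- \<alpha>) = 1"
proof -
  have "\<alpha> + - \<alpha> \<in> roots"
    using zero_root by simp
  then have "\<psi> (\<alpha> + - \<alpha>) = \<psi> \<alpha> * \<psi> (- \<alpha>)"
    using assms root_minus[OF assms(2)] unfolding character_iff by blast
  then show ?thesis
    using character_zero[OF assms(1)] by simp
qed

lemma diagonal_character:
  assumes "\<psi> \<in> carrier character_group"
  shows "diagonal \<psi> \<in> carrier Cartan_group"
  unfolding Cartan_iff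
proof (intro conjI allI ballI)
  have "diagonal \<psi> \<circ> diagonal (\<lambda>\<alpha>. 1 / \<psi> \<alpha>) = id" "diagonal (\<lambda>\<alpha>. 1 / \<psi> \<alpha>) \<circ> diagonal \<psi> = id"
    using diagonal_compose[of "\<lambda>_. 1"] character_nonzero[OF assms] by (simp_all add: diagonal_one)
  then show "bij (diagonal \<psi>)"
    using o_bij by blast
  show "diagonal \<psi> (bracket x y) = bracket (diagonal \<psi> x) (diagonal \<psi> y)" for x y
  proof (rule bracket_preserving_on_root_spaces[OF linear_diagonal])
    fix \<alpha> \<beta> x y
    assume *: "\<alpha> \<in> roots" "\<beta> \<in> roots" "x \<in> root_space \<alpha>" "y \<in> root_space \<beta>"
    show "diagonal \<psi> (bracket x y) = bracket (diagonal \<psi> x) (diagonal \<psi> y)"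
    proof (cases "bracket x y = 0")
      case True
      interpret Vector_Spaces.linear scale scale "diagonal \<psi>" by (rule linear_diagonal)
      show ?thesis
        using True * by (simp add: diagonal_root_space zero bracket_scale_left bracket_scale_right)
    next
      case False
      then have "\<alpha> + \<beta> \<in> roots"
        using root_bracket * by blast
      then show ?thesis
        using * assms root_space_bracket[OF *(3,4)]
        by (simp add: diagonal_root_space bracket_scale_left bracket_scale_right character_iff mult.commute)
    qed
  qed
  show "diagonal \<psi> h = h" if "h \<in> H" for h
    using that diagonal_root_space[OF zero_root, of h \<psi>] character_zero[OF assms] root_space_zero by simp
qed (rule linear_diagonal)

lemma Aut_power: "\<Psi> [^]\<^bsub>Aut\<^esub> (m :: nat) = \<Psi> ^^ m"
proof (induction m)
  case (Suc m)
  have "\<Psi> [^]\<^bsub>Aut\<^esub> Suc m = (\<Psi> [^]\<^bsub>Aut\<^esub> m) \<circ> \<Psi>"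
    by (simp add: nat_pow_def Aut_def)
  then show ?case
    by (simp only: Suc funpow_Suc_right)
qed (simp add: nat_pow_def Aut_def)

lemma Cartan_power: "\<Psi> [^]\<^bsub>Cartan_group\<^esub> (m :: nat) = \<Psi> ^^ m"
  unfolding Aut_power[symmetric] by (simp add: nat_pow_def Cartan_group_def)

lemma finite_order_Aut: "finite_order Aut \<Psi> \<longleftrightarrow> (\<exists>m>0. \<Psi> ^^ m = id)"
  by (simp add: finite_order_def Aut_power) (simp add: Aut_def)

lemma finite_order_Cartan: "finite_order Cartan_group \<Psi> \<longleftrightarrow> (\<exists>m>0. \<Psi> ^^ m = id)"
  by (simp add: finite_order_def Cartan_power) (simp add: Cartan_group_def Aut_def)

lemma character_power: "\<psi> [^]\<^bsub>character_group\<^esub> (m :: nat) = (\<lambda>\<alpha>\<in>roots. \<psi> \<alpha> ^ m)"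
proof (induction m)
  case (Suc m)
  have "\<psi> [^]\<^bsub>character_group\<^esub> Suc m = (\<lambda>\<alpha>\<in>roots. (\<psi> [^]\<^bsub>character_group\<^esub> m) \<alpha> * \<psi> \<alpha>)"
    by (simp add: nat_pow_def character_group_def)
  then show ?case
    unfolding Suc by (auto intro!: restrict_ext simp: mult.commute)
qed (simp add: nat_pow_def character_group_def)

lemma finite_order_character:
  "finite_order character_group \<psi> \<longleftrightarrow> (\<exists>m>0. \<forall>\<alpha>\<in>roots. \<psi> \<alpha> ^ m = 1)"
proof -
  have "(\<lambda>\<alpha>\<in>roots. \<psi> \<alpha> ^ m) = (\<lambda>\<alpha>\<in>roots. 1) \<longleftrightarrow> (\<forall>\<alpha>\<in>roots. \<psi> \<alpha> ^ m = 1)" for m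
    by (auto simp: fun_eq_iff restrict_def)
  then show ?thesis
    by (simp add: finite_order_def character_power) (simp add: character_group_def)
qed

lemma carrier_fin_part: "x \<in> carrier (fin_part G) \<longleftrightarrow> x \<in> carrier G \<and> finite_order G x"
  by (simp add: fin_part_def)

lemma group_fin_characters: "group (fin_part character_group)"
proof (rule groupI)
  note defs = carrier_fin_part finite_order_character
  have mult: "\<psi> \<otimes>\<^bsub>fin_part character_group\<^esub> \<phi> = (\<lambda>\<alpha>\<in>roots. \<psi> \<alpha> * \<phi> \<alpha>)" for \<psi> \<phi>
    by (simp add: fin_part_def character_group_def)
  have one: "\<one>\<^bsub>fin_part character_group\<^esub> = (\<lambda>\<alpha>\<in>roots. 1)"
    by (simp add: fin_part_def character_group_def)
  show "\<one>\<^bsub>fin_part character_group\<^esub> \<in> carrier (fin_part character_group)"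
    unfolding one defs by (auto simp: character_iff intro: exI[of _ 1])
  fix \<psi> assume \<psi>: "\<psi> \<in> carrier (fin_part character_group)"
  then obtain m where m: "m > 0" "\<forall>\<alpha>\<in>roots. \<psi> \<alpha> ^ m = 1" and \<psi>': "\<psi> \<in> carrier character_group"
    by (auto simp: defs)
  show "\<one>\<^bsub>fin_part character_group\<^esub> \<otimes>\<^bsub>fin_part character_group\<^esub> \<psi> = \<psi>"
    unfolding mult one using \<psi>' by (auto simp: character_iff fun_eq_iff PiE_def extensional_def)
  show "\<exists>\<phi>\<in>carrier (fin_part character_group). \<phi> \<otimes>\<^bsub>fin_part character_group\<^esub> \<psi> = \<one>\<^bsub>fin_part character_group\<^esub>"
  proof
    show "(\<lambda>\<alpha>\<in>roots. 1 / \<psi> \<alpha>) \<otimes>\<^bsub>fin_part character_group\<^esub> \<psi> = \<one>\<^bsub>fin_part character_group\<^esub>"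
      unfolding mult one using character_nonzero[OF \<psi>'] by (auto intro!: restrict_ext)
    show "(\<lambda>\<alpha>\<in>roots. 1 / \<psi> \<alpha>) \<in> carrier (fin_part character_group)"
      unfolding defs using \<psi>' m
      by (auto simp: character_iff power_divide intro!: exI[of _ m])
  qed
  fix \<phi> assume \<phi>: "\<phi> \<in> carrier (fin_part character_group)"
  then obtain n where n: "n > 0" "\<forall>\<alpha>\<in>roots. \<phi> \<alpha> ^ n = 1" and \<phi>': "\<phi> \<in> carrier character_group"
    by (auto simp: defs)
  have "(\<psi> \<alpha> * \<phi> \<alpha>) ^ (m * n) = (\<psi> \<alpha> ^ m) ^ n * (\<phi> \<alpha> ^ n) ^ m" for \<alpha>
    by (simp add: power_mult_distrib mult.commute flip: power_mult)
  then have "\<forall>\<alpha>\<in>roots. (\<psi> \<alpha> * \<phi> \<alpha>) ^ (m * n) = 1"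
    using m(2) n(2) by simp
  then show "\<psi> \<otimes>\<^bsub>fin_part character_group\<^esub> \<phi> \<in> carrier (fin_part character_group)"
    unfolding mult defs using \<psi>' \<phi>' m(1) n(1)
    by (auto simp: character_iff PiE_iff intro!: exI[of _ "m * n"])
  fix \<chi>
  show "\<psi> \<otimes>\<^bsub>fin_part character_group\<^esub> \<phi> \<otimes>\<^bsub>fin_part character_group\<^esub> \<chi>
      = \<psi> \<otimes>\<^bsub>fin_part character_group\<^esub> (\<phi> \<otimes>\<^bsub>fin_part character_group\<^esub> \<chi>)"
    unfolding mult by (auto intro!: restrict_ext simp: mult.assoc)
qed

end

section \<open>Cartan automorphisms of finite order\<close>

context eala
begin

lemma Cartan_linear: "\<Psi> \<in> carrier Cartan_group \<Longrightarrow> Vector_Spaces.linear scale scale \<Psi>"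
  and Cartan_inj: "\<Psi> \<in> carrier Cartan_group \<Longrightarrow> inj \<Psi>"
  and Cartan_bracket: "\<Psi> \<in> carrier Cartan_group \<Longrightarrow> \<Psi> (bracket x y) = bracket (\<Psi> x) (\<Psi> y)"
  and Cartan_H: "\<Psi> \<in> carrier Cartan_group \<Longrightarrow> h \<in> H \<Longrightarrow> \<Psi> h = h"
  by (auto simp: Cartan_iff bij_is_inj)

lemma Cartan_root_space:
  assumes "\<Psi> \<in> carrier Cartan_group" "x \<in> root_space \<alpha>"
  shows "\<Psi> x \<in> root_space \<alpha>"
  unfolding root_space_def
proof (intro CollectI ballI)
  interpret Vector_Spaces.linear scale scale \<Psi> by (rule Cartan_linear[OF assms(1)])
  fix h assume h: "h \<in> H"
  then have "bracket h (\<Psi> x) = \<Psi> (bracket h x)"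
    using Cartan_bracket[OF assms(1)] Cartan_H[OF assms(1)] by simp
  then show "bracket h (\<Psi> x) = scale (\<alpha> h) (\<Psi> x)"
    using root_spaceD[OF assms(2) h] by (simp add: scale)
qed

lemma Cartan_eigenvalue:
  assumes "\<Psi> \<in> carrier Cartan_group" "\<alpha> \<in> nonisotropic_roots"
  obtains c where "c \<noteq> 0" "\<And>x. x \<in> root_space \<alpha> \<Longrightarrow> \<Psi> x = scale c x"
proof -
  interpret Vector_Spaces.linear scale scale \<Psi> by (rule Cartan_linear[OF assms(1)])
  obtain x where x: "x \<in> root_space \<alpha>" "x \<noteq> 0"
    using root_vector[OF nonisotropic_root[OF assms(2)]] .
  obtain c where c: "\<Psi> x = scale c x"
    using root_space_one_dimensional[OF assms(2) x Cartan_root_space[OF assms(1) x(1)]] .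
  have "\<Psi> x \<noteq> 0"
    using Cartan_inj[OF assms(1)] x(2) zero by (metis injD)
  then have "c \<noteq> 0"
    using c by auto
  moreover have "\<Psi> y = scale c y" if y: "y \<in> root_space \<alpha>" for y
  proof -
    obtain d where "y = scale d x"
      using root_space_one_dimensional[OF assms(2) x y] .
    then show ?thesis
      by (simp add: scale c mult.commute)
  qed
  ultimately show thesis by (rule that)
qed

lemma funpow_eigenvector:
  assumes "Vector_Spaces.linear scale scale f" "f x = scale c x"
  shows "(f ^^ m) x = scale (c ^ m) x"
proof -
  interpret Vector_Spaces.linear scale scale f by fact
  show ?thesis by (induction m) (simp_all add: scale assms(2))
qed

text \<open>
  The bracket of opposite root vectors lies in \<open>H\<close>, where both automorphisms are the identity; so the
  scalar on one of the two root spaces is the inverse of the scalar on the other.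
\<close>

lemma Cartan_agree_opposite:
  assumes "\<Psi> \<in> carrier Cartan_group" "\<Phi> \<in> carrier Cartan_group" "\<alpha> \<in> nonisotropic_roots"
    and agree: "\<And>x. x \<in> root_space \<alpha> \<Longrightarrow> \<Psi> x = \<Phi> x"
    and y: "y \<in> root_space (- \<alpha>)"
  shows "\<Psi> y = \<Phi> y"
proof (rule ccontr)
  have \<alpha>: "\<alpha> \<in> dual" "- \<alpha> \<in> dual" "dual_form \<alpha> \<alpha> \<noteq> 0"
    using assms(3) by (auto simp: nonisotropic_iff root_dual dual_minus)
  define z where "z = \<Psi> y - \<Phi> y"
  assume "\<Psi> y \<noteq> \<Phi> y"
  then have z: "z \<in> root_space (- \<alpha>)" "z \<noteq> 0"
    using assms(1,2) y by (simp_all add: z_def root_space_closed Cartan_root_space)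
  obtain x where x: "x \<in> root_space \<alpha>" "form z x \<noteq> 0"
    using form_pairing[OF \<alpha>(2) z] by auto
  have "bracket x y \<in> H"
    using root_space_bracket[OF x(1) y] by (simp add: root_space_zero)
  then have "bracket (\<Psi> x) (\<Psi> y) = bracket (\<Phi> x) (\<Phi> y)"
    using Cartan_bracket Cartan_H assms(1,2) by metis
  then have "bracket (\<Psi> x) z = 0"
    using agree[OF x(1)] by (simp add: z_def bracket_diff)
  moreover obtain c where c: "c \<noteq> 0" "\<Psi> x = scale c x"
    using Cartan_eigenvalue[OF assms(1,3)] x(1) by metis
  ultimately have "bracket x z = 0"
    by (simp add: bracket_scale_left)
  then have "scale (form x z) (t \<alpha>) = 0"
    using bracket_opposite[OF \<alpha>(1) x(1) z(1)] by simp
  moreover have "t \<alpha> \<noteq> 0"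
    using \<alpha>(3) by (auto simp: dual_form_def)
  ultimately show False
    using x(2) by (simp add: form_sym)
qed

text \<open>
  A suitable power of \<open>ad g\<close>, with a root vector \<open>g\<close> for \<open>\<plusminus>\<alpha>\<close>, carries a root vector for \<open>\<beta>\<close> to a nonzero
  one for the reflected root. The two automorphisms agree on \<open>g\<close>, hence on this image, which spans its
  one-dimensional root space.
\<close>

lemma Cartan_agree_reflection:
  assumes "\<Psi> \<in> carrier Cartan_group" "\<Phi> \<in> carrier Cartan_group"
    and \<alpha>: "\<alpha> \<in> nonisotropic_roots" and \<beta>: "\<beta> \<in> nonisotropic_roots"
    and agree_\<alpha>: "\<And>x. x \<in> root_space \<alpha> \<Longrightarrow> \<Psi> x = \<Phi> x"
    and agree_\<beta>: "\<And>x. x \<in> root_space \<beta> \<Longrightarrow> \<Psi> x = \<Phi> x"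
    and y: "y \<in> root_space (reflection \<alpha> \<beta>)"
  shows "\<Psi> y = \<Phi> y"
proof -
  obtain x where x: "x \<in> root_space \<beta>" "x \<noteq> 0"
    using root_vector[OF nonisotropic_root[OF \<beta>]] .
  obtain n k \<gamma> g where n: "2 * dual_form \<alpha> \<beta> / dual_form \<alpha> \<alpha> = of_int n"
    and \<gamma>: "\<gamma> = \<alpha> \<or> \<gamma> = - \<alpha>"
    and g: "g \<in> root_space \<gamma>" "(bracket g ^^ k) x \<noteq> 0" "zscale (int k) \<gamma> = - zscale n \<alpha>"
    using reflected_root_vector[OF \<alpha> nonisotropic_root[OF \<beta>] x] by metis
  have agree_g: "\<Psi> g = \<Phi> g"
    using \<gamma> g(1) agree_\<alpha> Cartan_agree_opposite[OF assms(1,2) \<alpha> agree_\<alpha>] by blast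
  have agree: "\<Psi> ((bracket g ^^ j) x) = \<Phi> ((bracket g ^^ j) x)" for j
    by (induction j) (simp_all add: agree_\<beta> x(1) agree_g Cartan_bracket assms(1,2))
  have "(bracket g ^^ k) x \<in> root_space (reflection \<alpha> \<beta>)"
    using root_space_power[OF g(1) x(1), of k] reflection_root_eq[OF root_dual[OF nonisotropic_root[OF \<beta>]] n]
    by (simp add: g(3))
  then obtain c where c: "y = scale c ((bracket g ^^ k) x)"
    using root_space_one_dimensional[OF reflection_nonisotropic[OF \<alpha> \<beta>] _ g(2) y] by metis
  interpret P: Vector_Spaces.linear scale scale \<Psi> by (rule Cartan_linear[OF assms(1)])
  interpret F: Vector_Spaces.linear scale scale \<Phi> by (rule Cartan_linear[OF assms(2)])
  show ?thesis
    by (simp add: c P.scale F.scale agree)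
qed

lemma Cartan_agree_nonisotropic:
  assumes "\<Psi> \<in> carrier Cartan_group" "\<Phi> \<in> carrier Cartan_group" "reflectable P"
    and agree: "\<And>\<alpha> x. \<alpha> \<in> P \<Longrightarrow> x \<in> root_space \<alpha> \<Longrightarrow> \<Psi> x = \<Phi> x"
    and "\<beta> \<in> nonisotropic_roots" "x \<in> root_space \<beta>"
  shows "\<Psi> x = \<Phi> x"
proof -
  let ?S = "{\<beta> \<in> nonisotropic_roots. \<forall>x\<in>root_space \<beta>. \<Psi> x = \<Phi> x}"
  have P: "P \<subseteq> nonisotropic_roots" "nonisotropic_roots = {w \<alpha> |w \<alpha>. w \<in> refl_group P \<and> \<alpha> \<in> P}"
    using assms(3) by (simp_all add: reflectable_def)
  have invariant: "reflection \<alpha> \<gamma> \<in> ?S" if "\<alpha> \<in> P" "\<gamma> \<in> ?S" for \<alpha> \<gamma>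
    using that P(1) reflection_nonisotropic Cartan_agree_reflection[OF assms(1,2), of \<alpha> \<gamma>] agree by blast
  obtain w \<alpha> where w: "w \<in> refl_group P" "\<alpha> \<in> P" "\<beta> = w \<alpha>"
    using assms(5) P(2) by auto
  have "w \<alpha> \<in> ?S"
  proof (rule refl_group_invariant[OF w(1) P(1) _ invariant])
    show "?S \<subseteq> dual"
      by (auto simp: nonisotropic_iff root_dual)
    show "\<alpha> \<in> ?S"
      using w(2) P(1) agree by auto
  qed
  then show ?thesis
    using w(3) assms(6) by blast
qed

lemma Cartan_agree_core:
  assumes "\<Psi> \<in> carrier Cartan_group" "\<Phi> \<in> carrier Cartan_group"
    and "\<And>\<beta> x. \<beta> \<in> nonisotropic_roots \<Longrightarrow> x \<in> root_space \<beta> \<Longrightarrow> \<Psi> x = \<Phi> x"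
    and "x \<in> core"
  shows "\<Psi> x = \<Phi> x"
proof -
  interpret P: Vector_Spaces.linear scale scale \<Psi> by (rule Cartan_linear[OF assms(1)])
  interpret F: Vector_Spaces.linear scale scale \<Phi> by (rule Cartan_linear[OF assms(2)])
  have "subalgebra {x. \<Psi> x = \<Phi> x}"
    by (auto simp: Cartan_bracket[OF assms(1)] Cartan_bracket[OF assms(2)] subalgebra_def subspace_def P.zero F.zero P.add F.add P.scale F.scale)
  then have "core \<subseteq> {x. \<Psi> x = \<Phi> x}"
    using assms(3) by (intro core_induct) auto
  then show ?thesis
    using assms(4) by blast
qed

text \<open>
  On a root space, where a diagonal automorphism is multiplication by some \<open>c\<close>, the difference
  \<open>u = \<Psi> x - c x\<close> commutes with the core because \<open>\<Psi>\<close> is diagonal there. By tameness \<open>u\<close> lies in the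
  core, so \<open>\<Psi> u = c u\<close> and \<open>\<Psi>\<^sup>m x = c\<^sup>m x + m c\<^sup>m\<^sup>-\<^sup>1 u\<close>: a nonzero \<open>u\<close> is a Jordan block, which
  an automorphism of finite order does not have.
\<close>

lemma finite_order_Cartan_diagonal:
  assumes \<Psi>: "\<Psi> \<in> carrier Cartan_group" and \<psi>: "\<psi> \<in> carrier character_group"
    and agree: "\<And>\<beta> x. \<beta> \<in> nonisotropic_roots \<Longrightarrow> x \<in> root_space \<beta> \<Longrightarrow> \<Psi> x = diagonal \<psi> x"
    and m: "m > 0" "\<Psi> ^^ m = id" "\<And>\<alpha>. \<alpha> \<in> roots \<Longrightarrow> \<psi> \<alpha> ^ m = 1"
  shows "\<Psi> = diagonal \<psi>"
proof (rule linear_eq_on_root_spaces[OF Cartan_linear[OF \<Psi>] linear_diagonal])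
  interpret P: Vector_Spaces.linear scale scale \<Psi> by (rule Cartan_linear[OF \<Psi>])
  fix \<sigma> x assume \<sigma>: "\<sigma> \<in> roots" and x: "x \<in> root_space \<sigma>"
  define c where "c = \<psi> \<sigma>"
  define u where "u = \<Psi> x - scale c x"
  have D: "diagonal \<psi> \<in> carrier Cartan_group"
    by (rule diagonal_character[OF \<psi>])
  have agree_core: "\<Psi> z = diagonal \<psi> z" if "z \<in> core" for z
    by (rule Cartan_agree_core[OF \<Psi> D _ that]) (rule agree)
  have u: "u \<in> root_space \<sigma>"
    using Cartan_root_space[OF \<Psi> x] x by (simp add: u_def root_space_closed)
  have "u \<in> core"
  proof (rule centralizer_in_core)
    fix \<alpha> y assume \<alpha>: "\<alpha> \<in> nonisotropic_roots" and y: "y \<in> root_space \<alpha>"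
    have "\<Psi> (bracket x y) = diagonal \<psi> (bracket x y)"
      by (rule agree_core[OF core_absorbs(1)[OF \<sigma> \<alpha> x y]])
    then have "bracket (\<Psi> x) (\<Psi> y) = bracket (diagonal \<psi> x) (\<Psi> y)"
      using Cartan_bracket[OF \<Psi>] Cartan_bracket[OF D] agree[OF \<alpha> y] by simp
    then have "bracket u (\<Psi> y) = 0"
      by (simp add: u_def c_def bracket_diff diagonal_root_space[OF \<sigma> x])
    moreover obtain d where "d \<noteq> 0" "\<Psi> y = scale d y"
      using Cartan_eigenvalue[OF \<Psi> \<alpha>] y by metis
    ultimately show "bracket u y = 0"
      by (simp add: bracket_scale_right)
  qed
  then have \<Psi>u: "\<Psi> u = scale c u"
    using agree_core diagonal_root_space[OF \<sigma> u] by (simp add: c_def)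
  have \<Psi>x: "\<Psi> x = scale c x + u"
    by (simp add: u_def)
  have "(\<Psi> ^^ Suc k) x = scale (c ^ Suc k) x + scale (of_nat (Suc k) * c ^ k) u" for k
  proof (induction k)
    case 0
    then show ?case by (simp add: \<Psi>x)
  next
    case (Suc k)
    have "(\<Psi> ^^ Suc (Suc k)) x = scale (c ^ Suc k) (scale c x + u) + scale (of_nat (Suc k) * c ^ k) (scale c u)"
      unfolding funpow.simps(2)[of "Suc k"] o_apply Suc by (simp only: P.add P.scale \<Psi>x \<Psi>u)
    also have "\<dots> = scale (c ^ Suc (Suc k)) x + scale (c ^ Suc k + of_nat (Suc k) * c ^ Suc k) u"
      by (simp only: scale_right_distrib scale_left_distrib scale_scale mult.assoc add.assoc power_Suc2[symmetric])
    also have "c ^ Suc k + of_nat (Suc k) * c ^ Suc k = of_nat (Suc (Suc k)) * c ^ Suc k"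
      by (simp add: algebra_simps)
    finally show ?case .
  qed
  from this[of "m - 1"] have "x = scale 1 x + scale (of_nat m * c ^ (m - 1)) u"
    using m(1,2) m(3)[OF \<sigma>] by (simp add: c_def)
  then have "scale (of_nat m * c ^ (m - 1)) u = 0" by simp
  moreover have "c \<noteq> 0"
    using character_nonzero[OF \<psi> \<sigma>] by (simp add: c_def)
  ultimately have "u = 0"
    using m(1) by simp
  then show "\<Psi> x = diagonal \<psi> x"
    by (simp add: u_def c_def diagonal_root_space[OF \<sigma> x])
qed

text \<open>
  Since \<open>P\<close> is a basis of the root lattice, the values on \<open>P\<close> extend to a homomorphism of the whole
  lattice; its values are products of integral powers of the \<open>l \<beta>\<close>, so a common exponent of the \<open>l \<beta>\<close>
  is one for the homomorphism.
\<close>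

lemma character_on_independent_set:
  assumes "finite P" "int_fun.independent P" "int_fun.span P = int_fun.span roots"
    and "\<And>\<alpha>. \<alpha> \<in> P \<Longrightarrow> l \<alpha> \<noteq> 0"
  shows "\<exists>\<psi>\<in>carrier character_group. (\<forall>\<alpha>\<in>P \<inter> roots. \<psi> \<alpha> = l \<alpha>) \<and>
    (\<forall>m. (\<forall>\<beta>\<in>P. l \<beta> ^ m = 1) \<longrightarrow> (\<forall>\<alpha>\<in>roots. \<psi> \<alpha> ^ m = 1))"
proof -
  let ?r = "int_fun.representation P"
  define \<psi> where "\<psi> = (\<lambda>\<alpha>\<in>roots. \<Prod>p\<in>P. l p powi ?r \<alpha> p)"
  have span: "\<alpha> \<in> int_fun.span P" if "\<alpha> \<in> roots" for \<alpha>
    using that assms(3) int_fun.span_base by blast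
  show ?thesis
  proof (intro bexI[of _ \<psi>] conjI ballI allI impI)
    show "\<psi> \<in> carrier character_group"
      unfolding character_iff
    proof (intro conjI ballI impI)
      show "\<psi> \<in> roots \<rightarrow>\<^sub>E (UNIV - {0})"
        using assms(1,4) by (auto simp: \<psi>_def)
      show "\<psi> (\<alpha> + \<beta>) = \<psi> \<alpha> * \<psi> \<beta>" if "\<alpha> \<in> roots" "\<beta> \<in> roots" "\<alpha> + \<beta> \<in> roots" for \<alpha> \<beta>
        using that assms(4) span
        by (simp add: \<psi>_def int_fun.representation_add[OF assms(2)] power_int_add flip: prod.distrib)
    qed
    show "\<psi> \<alpha> = l \<alpha>" if "\<alpha> \<in> P \<inter> roots" for \<alpha>
    proof -
      have \<alpha>: "\<alpha> \<in> P" "\<alpha> \<in> roots"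
        using that by auto
      have "(\<Prod>p\<in>P. l p powi ?r \<alpha> p) = (\<Prod>p\<in>P. if p = \<alpha> then l \<alpha> else 1)"
        by (rule prod.cong) (auto simp: int_fun.representation_basis[OF assms(2) \<alpha>(1)])
      then show ?thesis
        using \<alpha> assms(1) by (simp add: \<psi>_def)
    qed
    show "\<psi> \<alpha> ^ m = 1" if l: "\<forall>\<beta>\<in>P. l \<beta> ^ m = 1" and "\<alpha> \<in> roots" for m \<alpha>
    proof -
      have "(l p powi n) ^ m = 1" if "p \<in> P" for p n
        using bspec[OF l that] by (metis mult.commute power_int_1_left power_int_power power_int_power')
      then show ?thesis
        using \<open>\<alpha> \<in> roots\<close> by (simp add: \<psi>_def prod_power_distrib)
    qed
  qed
qed

text \<open>
  The eigenvalues on the root spaces of a reflectable lattice basis extend to a character. Its diagonal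
  automorphism agrees with \<open>\<Psi>\<close> on these root spaces, hence, by reflections, on all non-isotropic ones,
  and hence everywhere.
\<close>

lemma finite_order_Cartan_is_diagonal:
  assumes "root_index = 0" "\<Psi> \<in> carrier (fin_part Cartan_group)"
  obtains \<psi> where "\<psi> \<in> carrier (fin_part character_group)" "\<Psi> = diagonal \<psi>"
proof -
  obtain m where \<Psi>: "\<Psi> \<in> carrier Cartan_group" and m: "m > 0" "\<Psi> ^^ m = id"
    using assms(2) by (auto simp: carrier_fin_part finite_order_Cartan)
  obtain P where P: "reflectable P" "finite P" "int_fun.independent P"
    using reflectable_lattice_basis[OF assms(1)] .
  have P': "P \<subseteq> nonisotropic_roots"
    using P(1) by (simp add: reflectable_def)
  have "\<forall>\<alpha>\<in>P. \<exists>c. c \<noteq> 0 \<and> (\<forall>x\<in>root_space \<alpha>. \<Psi> x = scale c x)"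
    using P' Cartan_eigenvalue[OF \<Psi>] by (metis subsetD)
  then obtain l where l: "\<And>\<alpha>. \<alpha> \<in> P \<Longrightarrow> l \<alpha> \<noteq> 0"
    "\<And>\<alpha> x. \<alpha> \<in> P \<Longrightarrow> x \<in> root_space \<alpha> \<Longrightarrow> \<Psi> x = scale (l \<alpha>) x"
    by metis
  obtain \<psi> where \<psi>: "\<psi> \<in> carrier character_group" "\<forall>\<alpha>\<in>P \<inter> roots. \<psi> \<alpha> = l \<alpha>"
    "\<forall>m. (\<forall>\<beta>\<in>P. l \<beta> ^ m = 1) \<longrightarrow> (\<forall>\<alpha>\<in>roots. \<psi> \<alpha> ^ m = 1)"
    using character_on_independent_set[OF P(2,3) span_reflectable[OF P(1)], of l] l(1) by blast
  have "l \<alpha> ^ m = 1" if \<alpha>: "\<alpha> \<in> P" for \<alpha>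
  proof -
    obtain x where x: "x \<in> root_space \<alpha>" "x \<noteq> 0"
      using root_vector[OF nonisotropic_root[OF subsetD[OF P' \<alpha>]]] .
    then have "scale (l \<alpha> ^ m) x = scale 1 x"
      using funpow_eigenvector[OF Cartan_linear[OF \<Psi>] l(2)[OF \<alpha> x(1)], of m] m(2) by simp
    then show ?thesis
      using x(2) by (simp only: scale_cancel_right simp_thms)
  qed
  then have \<psi>_m: "\<psi> \<alpha> ^ m = 1" if "\<alpha> \<in> roots" for \<alpha>
    using \<psi>(3) that by blast
  have "\<Psi> x = diagonal \<psi> x" if "\<alpha> \<in> P" "x \<in> root_space \<alpha>" for \<alpha> x
    using that l(2) \<psi>(2) P' nonisotropic_root diagonal_root_space[OF _ that(2), of \<psi>] by auto
  then have "\<Psi> x = diagonal \<psi> x" if "\<beta> \<in> nonisotropic_roots" "x \<in> root_space \<beta>" for \<beta> x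
    using that Cartan_agree_nonisotropic[OF \<Psi> diagonal_character[OF \<psi>(1)] P(1)] by blast
  then have "\<Psi> = diagonal \<psi>"
    by (rule finite_order_Cartan_diagonal[OF \<Psi> \<psi>(1) _ m \<psi>_m])
  moreover have "\<psi> \<in> carrier (fin_part character_group)"
    using \<psi>(1) \<psi>_m m(1) by (auto simp: carrier_fin_part finite_order_character)
  ultimately show thesis
    using that by blast
qed

lemma diagonal_fin_character:
  assumes "\<psi> \<in> carrier (fin_part character_group)"
  shows "diagonal \<psi> \<in> carrier (fin_part Cartan_group)"
  using assms diagonal_character[of \<psi>] diagonal_one
  by (auto simp: carrier_fin_part finite_order_character finite_order_Cartan diagonal_power)

lemma fin_part_mult:
  "\<psi> \<otimes>\<^bsub>fin_part character_group\<^esub> \<phi> = (\<lambda>\<alpha>\<in>roots. \<psi> \<alpha> * \<phi> \<alpha>)"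
  "\<Psi> \<otimes>\<^bsub>fin_part Cartan_group\<^esub> \<Phi> = \<Psi> \<circ> \<Phi>"
  "\<one>\<^bsub>fin_part Cartan_group\<^esub> = id"
  by (simp_all add: fin_part_def character_group_def Cartan_group_def Aut_def)

lemma diagonal_mult: "diagonal (\<lambda>\<alpha>\<in>roots. \<psi> \<alpha> * \<phi> \<alpha>) = diagonal \<psi> \<circ> diagonal \<phi>"
  by (rule diagonal_compose[symmetric]) simp

lemma diagonal_iso:
  assumes "root_index = 0"
  shows "diagonal \<in> iso (fin_part character_group) (fin_part Cartan_group)"
proof (rule isoI)
  show "diagonal \<in> hom (fin_part character_group) (fin_part Cartan_group)"
    using diagonal_fin_character by (auto simp: hom_def fin_part_mult diagonal_mult)
  have "inj_on diagonal (carrier (fin_part character_group))"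
  proof (rule inj_onI)
    fix \<psi> \<phi>
    assume *: "\<psi> \<in> carrier (fin_part character_group)" "\<phi> \<in> carrier (fin_part character_group)"
      "diagonal \<psi> = diagonal \<phi>"
    then have "\<psi> \<in> extensional roots" "\<phi> \<in> extensional roots"
      by (auto simp: carrier_fin_part character_iff PiE_def)
    then show "\<psi> = \<phi>"
      using diagonal_inject[OF *(3)] extensionalityI by blast
  qed
  then show "bij_betw diagonal (carrier (fin_part character_group)) (carrier (fin_part Cartan_group))"
    using diagonal_fin_character finite_order_Cartan_is_diagonal[OF assms]
    by (auto simp: bij_betw_def) blast
qed

text \<open>
  Closure under composition is not automatic for elements of finite order; here it holds because
  diagonal maps commute.
\<close>

lemma group_fin_Cartan:
  assumes "root_index = 0"
  shows "group (fin_part Cartan_group)"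
proof (rule group.iso_imp_group[OF group_fin_characters])
  have iso: "diagonal \<in> iso (fin_part character_group) (fin_part Cartan_group)"
    by (rule diagonal_iso[OF assms])
  then show "fin_part character_group \<cong> fin_part Cartan_group"
    by (rule is_isoI)
  interpret characters: group "fin_part character_group"
    by (rule group_fin_characters)
  show "monoid (fin_part Cartan_group)"
  proof (rule monoidI)
    fix \<Psi> \<Phi> assume "\<Psi> \<in> carrier (fin_part Cartan_group)" "\<Phi> \<in> carrier (fin_part Cartan_group)"
    then obtain \<psi> \<phi> where "\<psi> \<in> carrier (fin_part character_group)" "\<Psi> = diagonal \<psi>"
      "\<phi> \<in> carrier (fin_part character_group)" "\<Phi> = diagonal \<phi>"
      using finite_order_Cartan_is_diagonal[OF assms] by metis
    then show "\<Psi> \<otimes>\<^bsub>fin_part Cartan_group\<^esub> \<Phi> \<in> carrier (fin_part Cartan_group)"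
      using diagonal_fin_character[OF characters.m_closed[of \<psi> \<phi>]]
      by (simp add: fin_part_mult diagonal_mult)
  next
    have "id \<in> carrier Cartan_group"
      by (simp add: Cartan_iff linear_id)
    then show "\<one>\<^bsub>fin_part Cartan_group\<^esub> \<in> carrier (fin_part Cartan_group)"
      by (auto simp: fin_part_mult carrier_fin_part finite_order_Cartan)
  qed (auto simp: fin_part_mult comp_assoc)
qed

section \<open>Automorphisms inverting the Cartan subalgebra\<close>

text \<open>
  Since \<open>\<tau>\<close> exchanges opposite root spaces, \<open>\<tau> \<Psi> \<tau>\<^sup>-\<^sup>1 = \<Psi>\<^sup>-\<^sup>1\<close> for a diagonal \<open>\<Psi>\<close>.
\<close>

lemma neg_aut_diagonal_square:
  assumes "\<tau> \<in> neg_auts" "\<psi> \<in> carrier character_group"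
  shows "(\<tau> \<circ> diagonal \<psi>) \<circ> (\<tau> \<circ> diagonal \<psi>) = \<tau> \<circ> \<tau>"
proof (rule linear_eq_on_root_spaces)
  have \<tau>: "Vector_Spaces.linear scale scale \<tau>" "\<And>x y. \<tau> (bracket x y) = bracket (\<tau> x) (\<tau> y)"
    "\<And>h. h \<in> H \<Longrightarrow> \<tau> h = - h"
    using assms(1) by (auto simp: neg_auts_def Aut_def)
  interpret Vector_Spaces.linear scale scale \<tau> by (rule \<tau>(1))
  interpret D: Vector_Spaces.linear scale scale "diagonal \<psi>" by (rule linear_diagonal)
  show "Vector_Spaces.linear scale scale (\<tau> \<circ> \<tau>)"
    "Vector_Spaces.linear scale scale ((\<tau> \<circ> diagonal \<psi>) \<circ> (\<tau> \<circ> diagonal \<psi>))"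
    using Vector_Spaces.linear_compose \<tau>(1) linear_diagonal by blast+
  fix \<alpha> x assume \<alpha>: "\<alpha> \<in> roots" and x: "x \<in> root_space \<alpha>"
  have "\<tau> x \<in> root_space (- \<alpha>)"
    unfolding root_space_def
  proof (intro CollectI ballI)
    fix h assume h: "h \<in> H"
    then have "\<tau> (- h) = h"
      using \<tau>(3)[of "- h"] by (simp add: H_closed)
    then have "bracket h (\<tau> x) = \<tau> (bracket (- h) x)"
      by (simp only: \<tau>(2))
    then show "bracket h (\<tau> x) = scale ((- \<alpha>) h) (\<tau> x)"
      using root_spaceD[OF x h] by (simp add: scale neg)
  qed
  then have "diagonal \<psi> (\<tau> x) = scale (\<psi> (- \<alpha>)) (\<tau> x)"
    by (rule diagonal_root_space[OF root_minus[OF \<alpha>]])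
  then show "((\<tau> \<circ> diagonal \<psi>) \<circ> (\<tau> \<circ> diagonal \<psi>)) x = (\<tau> \<circ> \<tau>) x"
    using character_minus[OF assms(2) \<alpha>]
    by (simp add: diagonal_root_space[OF \<alpha> x] scale D.scale)
qed

lemma neg_aut_times_Cartan:
  assumes "root_index = 0" "\<tau> \<in> neg_auts_fin" "\<Psi> \<in> carrier (fin_part Cartan_group)"
  shows "\<tau> \<circ> \<Psi> \<in> neg_auts_fin"
proof -
  obtain \<psi> where \<psi>: "\<psi> \<in> carrier (fin_part character_group)" "\<Psi> = diagonal \<psi>"
    using finite_order_Cartan_is_diagonal[OF assms(1,3)] .
  have \<tau>: "\<tau> \<in> neg_auts"
    using assms(2) by (simp add: neg_auts_fin_def)
  obtain m where m: "m > 0" "\<tau> ^^ m = id"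
    using assms(2) by (auto simp: neg_auts_fin_def finite_order_Aut)
  have "(\<tau> \<circ> \<Psi>) ^^ 2 = \<tau> ^^ 2"
    using neg_aut_diagonal_square[OF \<tau>, of \<psi>] \<psi> by (simp add: carrier_fin_part numeral_2_eq_2)
  then have "(\<tau> \<circ> \<Psi>) ^^ (2 * m) = (\<tau> ^^ 2) ^^ m"
    by (simp only: funpow_mult[symmetric])
  also have "\<dots> = (\<tau> ^^ m) ^^ 2"
    by (simp only: funpow_mult mult.commute)
  also have "\<dots> = id"
    by (simp add: m(2))
  finally have "finite_order Aut (\<tau> \<circ> \<Psi>)"
    using m(1) by (auto simp: finite_order_Aut intro!: exI[of _ "2 * m"])
  moreover have "\<tau> \<circ> \<Psi> \<in> neg_auts"
    using \<tau> assms(3) Vector_Spaces.linear_compose[of scale scale \<Psi> scale \<tau>]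
    by (auto simp: neg_auts_def Aut_def carrier_fin_part Cartan_iff bij_comp)
  ultimately show ?thesis
    by (simp add: neg_auts_fin_def)
qed

end

section \<open>Finite order characters and Cartan automorphisms\<close>

theorem theorem4p4p11:
  fixes scale :: "complex \<Rightarrow> 'e::ab_group_add \<Rightarrow> 'e"
    and bracket :: "'e \<Rightarrow> 'e \<Rightarrow> 'e"
    and form :: "'e \<Rightarrow> 'e \<Rightarrow> complex"
    and H :: "'e set"
  assumes "eala scale bracket form H"
    and "lie_algebra_with_form.reduced_type scale bracket form H"
    and "lie_algebra_with_form.root_rank scale bracket form H > 1"
    and "lie_algebra_with_form.root_index scale bracket form H = 0"
  shows "group (fin_part (lie_algebra_with_form.Cartan_group scale bracket H))
    \<and> group (fin_part (lie_algebra_with_form.character_group scale bracket H))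
    \<and> fin_part (lie_algebra_with_form.Cartan_group scale bracket H)
         \<cong> fin_part (lie_algebra_with_form.character_group scale bracket H)
    \<and> (\<forall>\<tau> \<in> lie_algebra_with_form.neg_auts_fin scale bracket H.
         \<tau> <#\<^bsub>complex_lie_algebra.Aut scale bracket\<^esub>
             carrier (fin_part (lie_algebra_with_form.Cartan_group scale bracket H))
           \<subseteq> lie_algebra_with_form.neg_auts_fin scale bracket H)"
proof -
  interpret eala scale bracket form H by (rule assms(1))
  have "fin_part Cartan_group \<cong> fin_part character_group"
    using group.iso_sym[OF group_fin_characters] is_isoI[OF diagonal_iso[OF assms(4)]] by blast
  moreover have "\<tau> <#\<^bsub>Aut\<^esub> carrier (fin_part Cartan_group) \<subseteq> neg_auts_fin" if "\<tau> \<in> neg_auts_fin" for \<tau>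
  proof -
    have "\<tau> \<otimes>\<^bsub>Aut\<^esub> \<Psi> = \<tau> \<circ> \<Psi>" for \<Psi>
      by (simp add: Aut_def)
    then show ?thesis
      using neg_aut_times_Cartan[OF assms(4) that] by (auto simp: l_coset_def)
  qed
  ultimately show ?thesis
    using group_fin_Cartan[OF assms(4)] group_fin_characters by blast
qed

end
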